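(* Let $G$ be a discrete group. A pseudomonoid with strict unit in the 2-category of discrete $G$-sets with twist is equivalent to the following data: (1) a monoid $(K,m,1)$, where $K$ is a $G$-set, $m:K\times K\to K$ is $G$-equivariant and $1\in K$ is a $G$-invariant element; (2) cochains $\alpha\in C^{2,1}(K\rtimes G,\mathbb T)$, $\beta\in C^{1,2}(K\rtimes G,\mathbb T)$, $\theta\in C^{0,3}(K\rtimes G,\mathbb T)$ such that $\alpha\oplus\beta\oplus\theta$ is a 3-cocycle in the total complex $\big(\mathrm{Tot}^*(A^{*,*}(K\rtimes G,\mathbb T)),\ \delta_G\oplus\delta_K^{(-1)^p}\big)$.
   Context: $\mathbb T=S^1$, written multiplicatively. **Double complex.** For a monoid $K$ (in particular a group) with a left action of $G$ by monoid automorphisms, written $g(k)$, let $C^{p,q}(K\rtimes G,\mathbb T)$ be the group of maps $F:G^p\times K^q\to\mathbb T$, values written $F[g_1|\dots|g_p||k_1|\dots|k_q]$, that equal $1$ whenever some $g_i$ or $k_j$ is the identity ($C^{0,0}=\mathbb T$). The differentials $\delta_G:C^{p,q}\to C^{p+1,q}$, $\delta_K:C^{p,q}\to C^{p,q+1}$ are $$(\delta_GF)[g_1|\dots|g_{p+1}||k_1|\dots|k_q]=F[g_2|\dots|g_{p+1}||k_1|\dots|k_q]\prod_{i=1}^pF[g_1|\dots|g_ig_{i+1}|\dots|g_{p+1}||k_1|\dots|k_q]^{(-1)^i}\cdot F[g_1|\dots|g_p||g_{p+1}(k_1)|\dots|g_{p+1}(k_q)]^{(-1)^{p+1}},$$ $$(\delta_KF)[g_1|\dots|g_p||k_1|\dots|k_{q+1}]=F[g_1|\dots|g_p||k_2|\dots|k_{q+1}]\prod_{j=1}^qF[g_1|\dots|g_p||k_1|\dots|k_jk_{j+1}|\dots|k_{q+1}]^{(-1)^j}\cdot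 F[g_1|\dots|g_p||k_1|\dots|k_q]^{(-1)^{q+1}}.$$ $A^{*,*}(K\rtimes G,\mathbb T)$ is the sub double complex of all $C^{p,q}$ with $q>0$. $\mathrm{Tot}^n$ is the direct sum over $p+q=n$, with differential $\delta_G\oplus\delta_K^{(-1)^p}$. **2-category of discrete $G$-sets with twist.** Objects: pairs $(X,\alpha)$ with $X$ a discrete left $G$-set and $\alpha:G\times G\times X\to\mathbb T$ normalized in the $G$-variables (value $1$ if some group entry is $1$) with $\delta_G\alpha=1$, i.e. $\alpha[\tau|\rho||x]\,\alpha[\sigma\tau|\rho||x]^{-1}\alpha[\sigma|\tau\rho||x]\,\alpha[\sigma|\tau||\rho x]^{-1}=1$. A 1-cell $(L,\beta):(X,\alpha_X)\to(Y,\alpha_Y)$ is a $G$-map $L:X\to Y$ and a map $\beta:G\times X\to\mathbb T$, normalized in $G$, with $\delta_G\beta=L^*\alpha_Y\cdot\alpha_X^{-1}$, i.e. $\beta[\tau||x]\beta[\sigma\tau||x]^{-1}\beta[\sigma||\tau x]=\alpha_Y[\sigma|\tau||L(x)]\alpha_X[\sigma|\tau||x]^{-1}$. A 2-cell $(L,\beta)\Rightarrow(L,\beta')$ (same $L$) is a map $\theta:X\to\mathbb T$ with $\theta[x]\theta[\sigma x]^{-1}=\beta'[\sigma||x]\beta[\sigma||x]^{-1}$. Composition: $(M,\beta_M)\circ(L,\beta_L)=(M\circ L,\,L^*(\beta_M)\beta_L)$; vertical composition of 2-cells is multiplication. Strict 2-monoidal structure: $(X,\alpha_X)\boxtimes(Y,\alpha_Y)=(X\times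 Y,\pi_1^*\alpha_X\cdot\pi_2^*\alpha_Y)$ with diagonal action, similarly for 1- and 2-cells; the unit object $\mathbf I$ is a one-point set with twist $1$. **Pseudomonoid** in a strict 2-monoidal 2-category $(\mathcal B,\boxtimes,\mathbf I)$: an object $\mathbf C$, 1-cells $\mathbf m:\mathbf C\boxtimes\mathbf C\to\mathbf C$ and $\mathbb I:\mathbf I\to\mathbf C$, 2-isomorphisms $a:\mathbf m\circ(\mathbf m\boxtimes\mathrm{id})\Rightarrow\mathbf m\circ(\mathrm{id}\boxtimes\mathbf m)$, $\ell:\mathbf m\circ(\mathbb I\boxtimes\mathrm{id})\Rightarrow\mathrm{id}$, $r:\mathbf m\circ(\mathrm{id}\boxtimes\mathbb I)\Rightarrow\mathrm{id}$, satisfying the pentagon identity for $a$ (the composite of $a\circ(\mathbf m\boxtimes\mathrm{id}\boxtimes\mathrm{id})$ and $a\circ(\mathrm{id}\boxtimes\mathrm{id}\boxtimes\mathbf m)$ equals the composite of $\mathbf m\circ(a\boxtimes\mathrm{id})$, $a\circ(\mathrm{id}\boxtimes\mathbf m\boxtimes\mathrm{id})$, $\mathbf m\circ(\mathrm{id}\boxtimes a)$) and the triangle identity ($\mathbf m\circ(\mathrm{id}\boxtimes\ell)$ composed with $a\circ(\mathrm{id}\boxtimes\mathbb I\boxtimes\mathrm{id})$ equals $\mathbf m\circ(r\boxtimes\mathrm{id})$). A pseudomonoid in the 2-category of $G$-sets with twist has **strict unit** if the cochain component of the 1-cell $\mathbb I$ is the constant $1$ and $\ell,r$ are identity 2-cells.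 The equivalence is the one in which the data $(K,m,1,\alpha,\beta,\theta)$ correspond to $\mathbf C=(K,\alpha)$, $\mathbf m=(m,\beta)$, $\mathbb I=( *\mapsto 1,\ 1)$, $a=\theta$. *)

theory Defs
  imports Complex_Main "HOL-Algebra.Group_Action" "HOL-Library.FuncSet" "HOL-Library.NList"
begin

text \<open>
  Conventions. The group \<open>G\<close> and all \<open>G\<close>-sets are given by carrier sets. All maps (actions, cochains,
  maps of \<open>G\<close>-sets) are extensional, i.e. \<open>undefined\<close> outside their domain, so that
  equality in HOL is equality of maps on the carriers. Since everything is discrete, no continuity
  conditions occur.
\<close>

abbreviation circle :: "complex set"  (* the group T *)
  where "circle \<equiv> {z. norm z = 1}"


section \<open>The double complex\<close>

text \<open>A cochain \<open>F[g1|...|gp||k1|...|kq]\<close> is a function of the pair of lists \<open>([g1,...,gp],[k1,...,kq])\<close>.\<close>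

type_synonym ('g, 'k) cochain = "'g list \<times> 'k list \<Rightarrow> complex"

definition contract :: "('a, 'm) monoid_scheme \<Rightarrow> nat \<Rightarrow> 'a list \<Rightarrow> 'a list"
  (* [x1,...,xn] is sent to [x1,...,xi * x(i+1),...,xn]; the index i is 1-based, list access 0-based *)
  where "contract M i xs = take (i - 1) xs @ [xs ! (i - 1) \<otimes>\<^bsub>M\<^esub> xs ! i] @ drop (Suc i) xs"

locale discrete_group = group G for G :: "('g, 'b) monoid_scheme" (structure)
begin

definition cochains ::
  "('k, 'c) monoid_scheme \<Rightarrow> nat \<Rightarrow> nat \<Rightarrow> ('g, 'k) cochain set"
  where "cochains K p q =
    {F \<in> nlists p (carrier G) \<times> nlists q (carrier K) \<rightarrow>\<^sub>E circle.
       \<forall>gs \<in> nlists p (carrier G). \<forall>ks \<in> nlists q (carrier K).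
         \<one> \<in> set gs \<or> \<one>\<^bsub>K\<^esub> \<in> set ks \<longrightarrow> F (gs, ks) = 1}"

definition one_cochain ::
  "('k, 'c) monoid_scheme \<Rightarrow> nat \<Rightarrow> nat \<Rightarrow> ('g, 'k) cochain"
  where "one_cochain K p q = (\<lambda>_ \<in> nlists p (carrier G) \<times> nlists q (carrier K). 1)"

text \<open>\<open>delta_G K \<phi> p q\<close> and \<open>delta_K K p q\<close> are the differentials on \<open>C\<^sup>p\<^sup>,\<^sup>q\<close>; \<open>\<phi>\<close> is the action on \<open>K\<close>.\<close>

definition delta_G ::
  "('k, 'c) monoid_scheme \<Rightarrow> ('g \<Rightarrow> 'k \<Rightarrow> 'k) \<Rightarrow> nat \<Rightarrow> nat \<Rightarrow> ('g, 'k) cochain \<Rightarrow> ('g, 'k) cochain"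
  where "delta_G K \<phi> p q F =
    (\<lambda>(gs, ks) \<in> nlists (Suc p) (carrier G) \<times> nlists q (carrier K).
       F (tl gs, ks)
       * (\<Prod>i = 1..p. F (contract G i gs, ks) powi ((-1) ^ i))
       * F (butlast gs, map (\<phi> (last gs)) ks) powi ((-1) ^ (p + 1)))"

definition delta_K ::
  "('k, 'c) monoid_scheme \<Rightarrow> nat \<Rightarrow> nat \<Rightarrow> ('g, 'k) cochain \<Rightarrow> ('g, 'k) cochain"
  where "delta_K K p q F =
    (\<lambda>(gs, ks) \<in> nlists p (carrier G) \<times> nlists (Suc q) (carrier K).
       F (gs, tl ks)
       * (\<Prod>j = 1..q. F (gs, contract K j ks) powi ((-1) ^ j))
       * F (gs, butlast ks) powi ((-1) ^ (q + 1)))"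

text \<open>The sub double complex \<open>A\<close> of all \<open>C\<^sup>p\<^sup>,\<^sup>q\<close> with \<open>q > 0\<close>, hence trivial in the row \<open>q = 0\<close>.\<close>

definition A_cochains ::
  "('k, 'c) monoid_scheme \<Rightarrow> nat \<Rightarrow> nat \<Rightarrow> ('g, 'k) cochain set"
  where "A_cochains K p q = (if q = 0 then {one_cochain K p 0} else cochains K p q)"

text \<open>
  An element of \<open>Tot\<^sup>n\<close> is a family \<open>c\<close> whose entry \<open>c p\<close> lies in bidegree \<open>(p, n - p)\<close>, for \<open>p \<le> n\<close>.
\<close>

definition Tot :: "('k, 'c) monoid_scheme \<Rightarrow> nat \<Rightarrow> (nat \<Rightarrow> ('g, 'k) cochain) set"
  where "Tot K n = (\<Pi>\<^sub>E p \<in> {..n}. A_cochains K p (n - p))"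

definition Tot_one :: "('k, 'c) monoid_scheme \<Rightarrow> nat \<Rightarrow> nat \<Rightarrow> ('g, 'k) cochain"
  where "Tot_one K n = (\<lambda>p \<in> {..n}. one_cochain K p (n - p))"

text \<open>
  The entry of the total differential in bidegree \<open>(p, n + 1 - p)\<close> receives \<open>delta_G\<close> of the entry
  \<open>(p - 1, n + 1 - p)\<close> and \<open>delta_K\<close>, to the power \<open>(-1)\<^sup>p\<close>, of the entry \<open>(p, n - p)\<close>.
\<close>

definition Tot_d ::
  "('k, 'c) monoid_scheme \<Rightarrow> ('g \<Rightarrow> 'k \<Rightarrow> 'k) \<Rightarrow> nat \<Rightarrow>
     (nat \<Rightarrow> ('g, 'k) cochain) \<Rightarrow> nat \<Rightarrow> ('g, 'k) cochain"
  where "Tot_d K \<phi> n c =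
    (\<lambda>p \<in> {..Suc n}. \<lambda>x \<in> nlists p (carrier G) \<times> nlists (Suc n - p) (carrier K).
       (if p = 0 then 1 else delta_G K \<phi> (p - 1) (Suc n - p) (c (p - 1)) x)
       * (if p = Suc n then 1 else delta_K K p (n - p) (c p) x powi ((-1) ^ p)))"

definition Tot_cocycle ::
  "('k, 'c) monoid_scheme \<Rightarrow> ('g \<Rightarrow> 'k \<Rightarrow> 'k) \<Rightarrow> nat \<Rightarrow> (nat \<Rightarrow> ('g, 'k) cochain) \<Rightarrow> bool"
  where "Tot_cocycle K \<phi> n c \<longleftrightarrow> c \<in> Tot K n \<and> Tot_d K \<phi> n c = Tot_one K (Suc n)"

text \<open>\<open>\<alpha> \<oplus> \<beta> \<oplus> \<theta>\<close> in \<open>Tot\<^sup>3\<close>; the entry of bidegree \<open>(3, 0)\<close> lies in a trivial group.\<close>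

definition direct_sum3 ::
  "('k, 'c) monoid_scheme \<Rightarrow> ('g, 'k) cochain \<Rightarrow> ('g, 'k) cochain \<Rightarrow> ('g, 'k) cochain \<Rightarrow>
     nat \<Rightarrow> ('g, 'k) cochain"
  where "direct_sum3 K \<alpha> \<beta> \<theta> = (\<lambda>p \<in> {..3}. [\<theta>, \<beta>, \<alpha>, one_cochain K 3 0] ! p)"

end


section \<open>The 2-category of discrete G-sets with twist\<close>

text \<open>
  Cells carry their sources and targets, so that composites, products and equations between cells
  can be written without mentioning them separately. The predicates \<open>is_obj\<close>, \<open>is_cell1\<close>, \<open>is_cell2\<close>
  single out the actual objects, 1-cells and 2-cells among the raw data.
\<close>

record ('g, 'x) tw_set =
  points :: "'x set"
  act :: "'g \<Rightarrow> 'x \<Rightarrow> 'x"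
  twist :: "'g \<times> 'g \<times> 'x \<Rightarrow> complex"

record ('g, 'x, 'y) cell1 =
  dom1 :: "('g, 'x) tw_set"
  cod1 :: "('g, 'y) tw_set"
  map1 :: "'x \<Rightarrow> 'y"
  cochain1 :: "'g \<times> 'x \<Rightarrow> complex"

record ('g, 'x, 'y) cell2 =
  src2 :: "('g, 'x, 'y) cell1"
  tgt2 :: "('g, 'x, 'y) cell1"
  cochain2 :: "'x \<Rightarrow> complex"

record ('g, 'x) pseudomon =
  obj :: "('g, 'x) tw_set"
  mul :: "('g, 'x \<times> 'x, 'x) cell1"
  unt :: "('g, unit, 'x) cell1"
  assoc2 :: "('g, ('x \<times> 'x) \<times> 'x, 'x) cell2"
  lunit2 :: "('g, unit \<times> 'x, 'x) cell2"
  runit2 :: "('g, 'x \<times> unit, 'x) cell2"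

context discrete_group
begin

definition is_Gset :: "'x set \<Rightarrow> ('g \<Rightarrow> 'x \<Rightarrow> 'x) \<Rightarrow> bool"
  where "is_Gset X \<phi> \<longleftrightarrow> group_action G X \<phi> \<and> \<phi> \<in> extensional (carrier G)"

definition is_obj :: "('g, 'x) tw_set \<Rightarrow> bool"
  where "is_obj X \<longleftrightarrow>
    is_Gset (points X) (act X) \<and>
    twist X \<in> carrier G \<times> carrier G \<times> points X \<rightarrow>\<^sub>E circle \<and>
    (\<forall>\<sigma> \<in> carrier G. \<forall>\<tau> \<in> carrier G. \<forall>x \<in> points X.
       \<sigma> = \<one> \<or> \<tau> = \<one> \<longrightarrow> twist X (\<sigma>, \<tau>, x) = 1) \<and>
    (\<forall>\<sigma> \<in> carrier G. \<forall>\<tau> \<in> carrier G. \<forall>\<rho> \<in> carrier G. \<forall>x \<in> points X.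
       twist X (\<tau>, \<rho>, x) * inverse (twist X (\<sigma> \<otimes> \<tau>, \<rho>, x))
         * twist X (\<sigma>, \<tau> \<otimes> \<rho>, x) * inverse (twist X (\<sigma>, \<tau>, act X \<rho> x)) = 1)"

definition is_cell1 :: "('g, 'x, 'y) cell1 \<Rightarrow> bool"
  where "is_cell1 f \<longleftrightarrow>
    is_obj (dom1 f) \<and> is_obj (cod1 f) \<and>
    map1 f \<in> points (dom1 f) \<rightarrow>\<^sub>E points (cod1 f) \<and>
    (\<forall>\<sigma> \<in> carrier G. \<forall>x \<in> points (dom1 f).
       map1 f (act (dom1 f) \<sigma> x) = act (cod1 f) \<sigma> (map1 f x)) \<and>
    cochain1 f \<in> carrier G \<times> points (dom1 f) \<rightarrow>\<^sub>E circle \<and>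
    (\<forall>x \<in> points (dom1 f). cochain1 f (\<one>, x) = 1) \<and>
    (\<forall>\<sigma> \<in> carrier G. \<forall>\<tau> \<in> carrier G. \<forall>x \<in> points (dom1 f).
       cochain1 f (\<tau>, x) * inverse (cochain1 f (\<sigma> \<otimes> \<tau>, x)) * cochain1 f (\<sigma>, act (dom1 f) \<tau> x)
       = twist (cod1 f) (\<sigma>, \<tau>, map1 f x) * inverse (twist (dom1 f) (\<sigma>, \<tau>, x)))"

definition is_cell2 :: "('g, 'x, 'y) cell2 \<Rightarrow> bool"
  where "is_cell2 t \<longleftrightarrow>
    is_cell1 (src2 t) \<and> is_cell1 (tgt2 t) \<and>
    dom1 (src2 t) = dom1 (tgt2 t) \<and> cod1 (src2 t) = cod1 (tgt2 t) \<and>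
    map1 (src2 t) = map1 (tgt2 t) \<and>
    cochain2 t \<in> points (dom1 (src2 t)) \<rightarrow>\<^sub>E circle \<and>
    (\<forall>\<sigma> \<in> carrier G. \<forall>x \<in> points (dom1 (src2 t)).
       cochain2 t x * inverse (cochain2 t (act (dom1 (src2 t)) \<sigma> x))
       = cochain1 (tgt2 t) (\<sigma>, x) * inverse (cochain1 (src2 t) (\<sigma>, x)))"


subsection \<open>Compositions and identities\<close>

definition id1 :: "('g, 'x) tw_set \<Rightarrow> ('g, 'x, 'x) cell1"
  where "id1 X = \<lparr>dom1 = X, cod1 = X, map1 = (\<lambda>x \<in> points X. x),
                  cochain1 = (\<lambda>_ \<in> carrier G \<times> points X. 1)\<rparr>"

definition comp1 :: "('g, 'y, 'z) cell1 \<Rightarrow> ('g, 'x, 'y) cell1 \<Rightarrow> ('g, 'x, 'z) cell1"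
    (infixr "\<circ>\<^sub>1" 65)
  where "g \<circ>\<^sub>1 f = \<lparr>dom1 = dom1 f, cod1 = cod1 g,
                  map1 = (\<lambda>x \<in> points (dom1 f). map1 g (map1 f x)),
                  cochain1 = (\<lambda>(\<sigma>, x) \<in> carrier G \<times> points (dom1 f).
                                cochain1 g (\<sigma>, map1 f x) * cochain1 f (\<sigma>, x))\<rparr>"

definition id2 :: "('g, 'x, 'y) cell1 \<Rightarrow> ('g, 'x, 'y) cell2"
  where "id2 f = \<lparr>src2 = f, tgt2 = f, cochain2 = (\<lambda>_ \<in> points (dom1 f). 1)\<rparr>"

text \<open>Vertical composite of \<open>t : f \<Rightarrow> g\<close> followed by \<open>s : g \<Rightarrow> h\<close>.\<close>

definition vcomp :: "('g, 'x, 'y) cell2 \<Rightarrow> ('g, 'x, 'y) cell2 \<Rightarrow> ('g, 'x, 'y) cell2"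
    (infixr "\<circ>\<^sub>v" 60)
  where "s \<circ>\<^sub>v t = \<lparr>src2 = src2 t, tgt2 = tgt2 s,
                  cochain2 = (\<lambda>x \<in> points (dom1 (src2 t)). cochain2 s x * cochain2 t x)\<rparr>"

text \<open>Whiskering of a 2-cell with a 1-cell after it, respectively before it.\<close>

definition whisker_post :: "('g, 'y, 'z) cell1 \<Rightarrow> ('g, 'x, 'y) cell2 \<Rightarrow> ('g, 'x, 'z) cell2"
    (infixr "\<triangleright>" 65)
  where "g \<triangleright> t = \<lparr>src2 = g \<circ>\<^sub>1 src2 t, tgt2 = g \<circ>\<^sub>1 tgt2 t, cochain2 = cochain2 t\<rparr>"

definition whisker_pre :: "('g, 'y, 'z) cell2 \<Rightarrow> ('g, 'x, 'y) cell1 \<Rightarrow> ('g, 'x, 'z) cell2"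
    (infixl "\<triangleleft>" 65)
  where "t \<triangleleft> f = \<lparr>src2 = src2 t \<circ>\<^sub>1 f, tgt2 = tgt2 t \<circ>\<^sub>1 f,
                   cochain2 = (\<lambda>x \<in> points (dom1 f). cochain2 t (map1 f x))\<rparr>"

definition is_iso2 :: "('g, 'x, 'y) cell2 \<Rightarrow> bool"
  where "is_iso2 t \<longleftrightarrow> is_cell2 t \<and>
    (\<exists>s. is_cell2 s \<and> src2 s = tgt2 t \<and> tgt2 s = src2 t \<and>
         s \<circ>\<^sub>v t = id2 (src2 t) \<and> t \<circ>\<^sub>v s = id2 (tgt2 t))"


subsection \<open>Monoidal structure\<close>

definition tensor0 :: "('g, 'x) tw_set \<Rightarrow> ('g, 'y) tw_set \<Rightarrow> ('g, 'x \<times> 'y) tw_set"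
    (infixr "\<boxtimes>\<^sub>0" 70)
  where "X \<boxtimes>\<^sub>0 Y =
    \<lparr>points = points X \<times> points Y,
     act = (\<lambda>\<sigma> \<in> carrier G. \<lambda>(x, y) \<in> points X \<times> points Y. (act X \<sigma> x, act Y \<sigma> y)),
     twist = (\<lambda>(\<sigma>, \<tau>, x, y) \<in> carrier G \<times> carrier G \<times> points X \<times> points Y.
                twist X (\<sigma>, \<tau>, x) * twist Y (\<sigma>, \<tau>, y))\<rparr>"

definition tensor1 ::
  "('g, 'x, 'u) cell1 \<Rightarrow> ('g, 'y, 'v) cell1 \<Rightarrow> ('g, 'x \<times> 'y, 'u \<times> 'v) cell1" (infixr "\<boxtimes>\<^sub>1" 70)
  where "f \<boxtimes>\<^sub>1 g =
    \<lparr>dom1 = dom1 f \<boxtimes>\<^sub>0 dom1 g, cod1 = cod1 f \<boxtimes>\<^sub>0 cod1 g,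
     map1 = (\<lambda>(x, y) \<in> points (dom1 f) \<times> points (dom1 g). (map1 f x, map1 g y)),
     cochain1 = (\<lambda>(\<sigma>, x, y) \<in> carrier G \<times> points (dom1 f) \<times> points (dom1 g).
                   cochain1 f (\<sigma>, x) * cochain1 g (\<sigma>, y))\<rparr>"

definition tensor2 ::
  "('g, 'x, 'u) cell2 \<Rightarrow> ('g, 'y, 'v) cell2 \<Rightarrow> ('g, 'x \<times> 'y, 'u \<times> 'v) cell2" (infixr "\<boxtimes>\<^sub>2" 70)
  where "s \<boxtimes>\<^sub>2 t =
    \<lparr>src2 = src2 s \<boxtimes>\<^sub>1 src2 t, tgt2 = tgt2 s \<boxtimes>\<^sub>1 tgt2 t,
     cochain2 = (\<lambda>(x, y) \<in> points (dom1 (src2 s)) \<times> points (dom1 (src2 t)).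
                   cochain2 s x * cochain2 t y)\<rparr>"

definition unit_obj :: "('g, unit) tw_set" ("\<^bold>I")
  where "\<^bold>I = \<lparr>points = UNIV, act = (\<lambda>\<sigma> \<in> carrier G. \<lambda>x. x),
              twist = (\<lambda>_ \<in> carrier G \<times> carrier G \<times> UNIV. 1)\<rparr>"

text \<open>
  Products of sets are strictly associative and unital only after identifying \<open>(X \<times> Y) \<times> Z\<close> with
  \<open>X \<times> (Y \<times> Z)\<close> and \<open>I \<times> X\<close>, \<open>X \<times> I\<close> with \<open>X\<close>. These types differ in HOL, so the identifications
  are written as the following 1-cells, the canonical bijections with cochain 1.
\<close>

definition assoc1 ::
  "('g, 'x) tw_set \<Rightarrow> ('g, 'y) tw_set \<Rightarrow> ('g, 'z) tw_set \<Rightarrow>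
     ('g, ('x \<times> 'y) \<times> 'z, 'x \<times> ('y \<times> 'z)) cell1"
  where "assoc1 X Y Z =
    \<lparr>dom1 = (X \<boxtimes>\<^sub>0 Y) \<boxtimes>\<^sub>0 Z, cod1 = X \<boxtimes>\<^sub>0 (Y \<boxtimes>\<^sub>0 Z),
     map1 = (\<lambda>((x, y), z) \<in> (points X \<times> points Y) \<times> points Z. (x, (y, z))),
     cochain1 = (\<lambda>_ \<in> carrier G \<times> ((points X \<times> points Y) \<times> points Z). 1)\<rparr>"

definition lunit1 :: "('g, 'x) tw_set \<Rightarrow> ('g, unit \<times> 'x, 'x) cell1"
  where "lunit1 X =
    \<lparr>dom1 = \<^bold>I \<boxtimes>\<^sub>0 X, cod1 = X, map1 = (\<lambda>(_, x) \<in> UNIV \<times> points X. x),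
     cochain1 = (\<lambda>_ \<in> carrier G \<times> (UNIV \<times> points X). 1)\<rparr>"

definition runit1 :: "('g, 'x) tw_set \<Rightarrow> ('g, 'x \<times> unit, 'x) cell1"
  where "runit1 X =
    \<lparr>dom1 = X \<boxtimes>\<^sub>0 \<^bold>I, cod1 = X, map1 = (\<lambda>(x, _) \<in> points X \<times> UNIV. x),
     cochain1 = (\<lambda>_ \<in> carrier G \<times> (points X \<times> UNIV). 1)\<rparr>"


subsection \<open>Pseudomonoids\<close>

text \<open>
  The pentagon is an equation between 2-cells of 1-cells \<open>((C \<boxtimes> C) \<boxtimes> C) \<boxtimes> C \<rightarrow> C\<close>, the triangle one
  between 2-cells of 1-cells \<open>(C \<boxtimes> I) \<boxtimes> C \<rightarrow> C\<close>.
\<close>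

definition pentagon :: "('g, 'x) pseudomon \<Rightarrow> bool"
  where "pentagon P \<longleftrightarrow>
    (let C = obj P; m = mul P; a = assoc2 P; i = id1 C; CC = C \<boxtimes>\<^sub>0 C in
       (a \<triangleleft> (((i \<boxtimes>\<^sub>1 i) \<boxtimes>\<^sub>1 m) \<circ>\<^sub>1 assoc1 CC C C)) \<circ>\<^sub>v (a \<triangleleft> ((m \<boxtimes>\<^sub>1 i) \<boxtimes>\<^sub>1 i))
     = ((m \<triangleright> (id2 i \<boxtimes>\<^sub>2 a)) \<triangleleft> (assoc1 C CC C \<circ>\<^sub>1 (assoc1 C C C \<boxtimes>\<^sub>1 i)))
       \<circ>\<^sub>v (a \<triangleleft> (((i \<boxtimes>\<^sub>1 m) \<boxtimes>\<^sub>1 i) \<circ>\<^sub>1 (assoc1 C C C \<boxtimes>\<^sub>1 i)))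
       \<circ>\<^sub>v (m \<triangleright> (a \<boxtimes>\<^sub>2 id2 i)))"

definition triangle :: "('g, 'x) pseudomon \<Rightarrow> bool"
  where "triangle P \<longleftrightarrow>
    (let C = obj P; m = mul P; u = unt P; i = id1 C in
       ((m \<triangleright> (id2 i \<boxtimes>\<^sub>2 lunit2 P)) \<triangleleft> assoc1 C \<^bold>I C)
         \<circ>\<^sub>v (assoc2 P \<triangleleft> ((i \<boxtimes>\<^sub>1 u) \<boxtimes>\<^sub>1 i))
     = m \<triangleright> (runit2 P \<boxtimes>\<^sub>2 id2 i))"

definition is_pseudomonoid :: "('g, 'x) pseudomon \<Rightarrow> bool"
  where "is_pseudomonoid P \<longleftrightarrow>
    (let C = obj P; m = mul P; u = unt P; i = id1 C in
       is_obj C \<and>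
       is_cell1 m \<and> dom1 m = C \<boxtimes>\<^sub>0 C \<and> cod1 m = C \<and>
       is_cell1 u \<and> dom1 u = \<^bold>I \<and> cod1 u = C \<and>
       is_iso2 (assoc2 P) \<and>
         src2 (assoc2 P) = m \<circ>\<^sub>1 (m \<boxtimes>\<^sub>1 i) \<and>
         tgt2 (assoc2 P) = m \<circ>\<^sub>1 (i \<boxtimes>\<^sub>1 m) \<circ>\<^sub>1 assoc1 C C C \<and>
       is_iso2 (lunit2 P) \<and>
         src2 (lunit2 P) = m \<circ>\<^sub>1 (u \<boxtimes>\<^sub>1 i) \<and> tgt2 (lunit2 P) = lunit1 C \<and>
       is_iso2 (runit2 P) \<and>
         src2 (runit2 P) = m \<circ>\<^sub>1 (i \<boxtimes>\<^sub>1 u) \<and> tgt2 (runit2 P) = runit1 C \<and>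
       pentagon P \<and> triangle P)"

definition has_strict_unit :: "('g, 'x) pseudomon \<Rightarrow> bool"
  where "has_strict_unit P \<longleftrightarrow>
    cochain1 (unt P) = (\<lambda>_ \<in> carrier G \<times> UNIV. 1) \<and>
    lunit2 P = id2 (src2 (lunit2 P)) \<and> runit2 P = id2 (src2 (runit2 P))"

end


section \<open>Monoids in G-sets with a 3-cocycle\<close>

record ('g, 'k) cocycle_data =
  set_of :: "'k set"
  act_of :: "'g \<Rightarrow> 'k \<Rightarrow> 'k"
  mul_of :: "'k \<times> 'k \<Rightarrow> 'k"
  one_of :: 'k
  alpha_of :: "('g, 'k) cochain"
  beta_of :: "('g, 'k) cochain"
  theta_of :: "('g, 'k) cochain"

definition monoid_of :: "('g, 'k) cocycle_data \<Rightarrow> 'k monoid"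
  where "monoid_of D =
    \<lparr>carrier = set_of D, mult = (\<lambda>x y. mul_of D (x, y)), one = one_of D\<rparr>"

context discrete_group
begin

definition is_cocycle_data :: "('g, 'k) cocycle_data \<Rightarrow> bool"
  where "is_cocycle_data D \<longleftrightarrow>
    (let K = set_of D; \<phi> = act_of D; m = mul_of D; M = monoid_of D in
       is_Gset K \<phi> \<and>
       m \<in> K \<times> K \<rightarrow>\<^sub>E K \<and>
       monoid M \<and>
       (\<forall>g \<in> carrier G. \<forall>x \<in> K. \<forall>y \<in> K. m (\<phi> g x, \<phi> g y) = \<phi> g (m (x, y))) \<and>
       (\<forall>g \<in> carrier G. \<phi> g (one_of D) = one_of D) \<and>
       alpha_of D \<in> cochains M 2 1 \<and>
       beta_of D \<in> cochains M 1 2 \<and>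
       theta_of D \<in> cochains M 0 3 \<and>
       Tot_cocycle M \<phi> 3 (direct_sum3 M (alpha_of D) (beta_of D) (theta_of D)))"

text \<open>The pseudomonoid \<open>C = (K, \<alpha>)\<close>, \<open>m = (m, \<beta>)\<close>, \<open>I = (() \<mapsto> 1, 1)\<close>, \<open>a = \<theta>\<close> with identities \<open>\<ell>\<close>, \<open>r\<close>.\<close>

definition pseudomonoid_of :: "('g, 'k) cocycle_data \<Rightarrow> ('g, 'k) pseudomon"
  where "pseudomonoid_of D =
    (let
       K = set_of D;
       C = \<lparr>points = K, act = act_of D,
            twist = (\<lambda>(\<sigma>, \<tau>, k) \<in> carrier G \<times> carrier G \<times> K. alpha_of D ([\<sigma>, \<tau>], [k]))\<rparr>;
       m = \<lparr>dom1 = C \<boxtimes>\<^sub>0 C, cod1 = C, map1 = mul_of D,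
            cochain1 = (\<lambda>(\<sigma>, k, l) \<in> carrier G \<times> K \<times> K. beta_of D ([\<sigma>], [k, l]))\<rparr>;
       u = \<lparr>dom1 = \<^bold>I, cod1 = C, map1 = (\<lambda>_. one_of D),
            cochain1 = (\<lambda>_ \<in> carrier G \<times> UNIV. 1)\<rparr>;
       i = id1 C
     in
       \<lparr>obj = C, mul = m, unt = u,
        assoc2 = \<lparr>src2 = m \<circ>\<^sub>1 (m \<boxtimes>\<^sub>1 i),
                  tgt2 = m \<circ>\<^sub>1 (i \<boxtimes>\<^sub>1 m) \<circ>\<^sub>1 assoc1 C C C,
                  cochain2 = (\<lambda>((k, l), n) \<in> (K \<times> K) \<times> K. theta_of D ([], [k, l, n]))\<rparr>,
        lunit2 = id2 (lunit1 C),
        runit2 = id2 (runit1 C)\<rparr>)"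

end

end

theory Submission
  imports Defs
begin

text \<open>
  All 2-cells are invertible, and the composite 1-cells occurring in the pentagon and the triangle
  agree on the nose, so each pseudomonoid axiom is equivalent to a pointwise identity of circle-valued
  functions. With a strict unit these identities are the equations of a total 3-cocycle, one per bidegree,
  together with most of the normalization conditions: \<open>\<alpha>\<close> is normalized in \<open>K\<close> because the unit is a
  1-cell with trivial cochain, \<open>\<beta>\<close> because \<open>\<ell>\<close> and \<open>r\<close> are identities, and the triangle gives
  \<open>\<theta>[k|1|l] = 1\<close>. The remaining \<open>\<theta>[1|k|l] = 1\<close> and \<open>\<theta>[k|l|1] = 1\<close> follow from the pentagon by
  inserting two adjacent units, which turns it into \<open>x = x * x\<close>.
\<close>


section \<open>Cells of the 2-category\<close>

context discrete_group
begin

text \<open>\<open>group_action\<close> is a homomorphism into \<open>BijGroup X\<close>. The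
  pointwise laws are equivalent to it because \<open>\<phi> (inv \<sigma>)\<close> inverts
  \<open>\<phi> \<sigma>\<close>, which makes bijectivity automatic; in this form the axioms can be
  checked by simplification.\<close>

lemma is_Gset_iff:
  "is_Gset X \<phi> \<longleftrightarrow> \<phi> \<in> carrier G \<rightarrow>\<^sub>E (X \<rightarrow>\<^sub>E X) \<and> (\<forall>x \<in> X. \<phi> \<one> x = x) \<and>
     (\<forall>\<sigma> \<in> carrier G. \<forall>\<tau> \<in> carrier G. \<forall>x \<in> X. \<phi> (\<sigma> \<otimes> \<tau>) x = \<phi> \<sigma> (\<phi> \<tau> x))"
proof
  assume *: "is_Gset X \<phi>"
  then interpret group_action G X \<phi>
    by (simp add: is_Gset_def)
  have "\<phi> \<sigma> \<in> X \<rightarrow>\<^sub>E X" if "\<sigma> \<in> carrier G" for \<sigma>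
    using bij_prop0[OF that] Bij_imp_funcset[of "\<phi> \<sigma>" X] by (auto simp: PiE_def Bij_def)
  moreover have "\<phi> \<one> x = x" if "x \<in> X" for x
    using that id_eq_one by (metis restrict_apply')
  ultimately show "\<phi> \<in> carrier G \<rightarrow>\<^sub>E (X \<rightarrow>\<^sub>E X) \<and> (\<forall>x \<in> X. \<phi> \<one> x = x) \<and>
     (\<forall>\<sigma> \<in> carrier G. \<forall>\<tau> \<in> carrier G. \<forall>x \<in> X. \<phi> (\<sigma> \<otimes> \<tau>) x = \<phi> \<sigma> (\<phi> \<tau> x))"
    using * composition_rule by (auto simp: PiE_def is_Gset_def)
next
  assume "\<phi> \<in> carrier G \<rightarrow>\<^sub>E (X \<rightarrow>\<^sub>E X) \<and> (\<forall>x \<in> X. \<phi> \<one> x = x) \<and>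
     (\<forall>\<sigma> \<in> carrier G. \<forall>\<tau> \<in> carrier G. \<forall>x \<in> X. \<phi> (\<sigma> \<otimes> \<tau>) x = \<phi> \<sigma> (\<phi> \<tau> x))"
  then have maps: "\<phi> \<in> carrier G \<rightarrow>\<^sub>E (X \<rightarrow>\<^sub>E X)"
    and one: "\<And>x. x \<in> X \<Longrightarrow> \<phi> \<one> x = x"
    and mult: "\<And>\<sigma> \<tau> x. \<sigma> \<in> carrier G \<Longrightarrow> \<tau> \<in> carrier G \<Longrightarrow> x \<in> X \<Longrightarrow> \<phi> (\<sigma> \<otimes> \<tau>) x = \<phi> \<sigma> (\<phi> \<tau> x)"
    by auto
  have closed: "\<phi> \<sigma> x \<in> X" if "\<sigma> \<in> carrier G" "x \<in> X" for \<sigma> x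
    using maps that by blast
  have inverse: "\<phi> (inv \<sigma>) (\<phi> \<sigma> x) = x" "\<phi> \<sigma> (\<phi> (inv \<sigma>) x) = x" if "\<sigma> \<in> carrier G" "x \<in> X" for \<sigma> x
    using that by (simp_all flip: mult add: one)
  have Bij: "\<phi> \<sigma> \<in> Bij X" if "\<sigma> \<in> carrier G" for \<sigma>
    unfolding Bij_def using maps that inverse closed
    by (auto simp: PiE_def intro!: bij_betw_byWitness[where f' = "\<phi> (inv \<sigma>)"])
  \<comment> \<open>Multiplication in \<open>BijGroup X\<close> is \<open>compose X\<close>, which
    is \<open>undefined\<close> off \<open>X\<close>, so extensionality is needed besides the action
    law.\<close>
  have "\<phi> (\<sigma> \<otimes> \<tau>) = compose X (\<phi> \<sigma>) (\<phi> \<tau>)" if "\<sigma> \<in> carrier G" "\<tau> \<in> carrier G" for \<sigma> \<tau>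
  proof (rule extensionalityI[where A = X])
    show "\<phi> (\<sigma> \<otimes> \<tau>) \<in> extensional X"
      using maps that by (auto simp: PiE_iff)
  qed (use that mult in \<open>auto simp: compose_def\<close>)
  then have "\<phi> \<in> hom G (BijGroup X)"
    using Bij by (intro homI) (auto simp: BijGroup_def)
  then have "group_action G X \<phi>"
    using is_group group_BijGroup by (auto simp: group_action_def group_hom_def group_hom_axioms_def)
  then show "is_Gset X \<phi>"
    using maps by (auto simp: is_Gset_def PiE_def)
qed

lemma is_objD:
  assumes "is_obj X"
  shows act_closed: "\<sigma> \<in> carrier G \<Longrightarrow> x \<in> points X \<Longrightarrow> act X \<sigma> x \<in> points X"
    and act_one: "x \<in> points X \<Longrightarrow> act X \<one> x = x"
    and act_mult: "\<sigma> \<in> carrier G \<Longrightarrow> \<tau> \<in> carrier G \<Longrightarrow> x \<in> points X \<Longrightarrow>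
      act X (\<sigma> \<otimes> \<tau>) x = act X \<sigma> (act X \<tau> x)"
    and norm_twist: "\<sigma> \<in> carrier G \<Longrightarrow> \<tau> \<in> carrier G \<Longrightarrow> x \<in> points X \<Longrightarrow> norm (twist X (\<sigma>, \<tau>, x)) = 1"
    and twist_one: "\<tau> \<in> carrier G \<Longrightarrow> x \<in> points X \<Longrightarrow> twist X (\<one>, \<tau>, x) = 1"
      "\<sigma> \<in> carrier G \<Longrightarrow> x \<in> points X \<Longrightarrow> twist X (\<sigma>, \<one>, x) = 1"
    and twist_cocycle: "\<sigma> \<in> carrier G \<Longrightarrow> \<tau> \<in> carrier G \<Longrightarrow> \<rho> \<in> carrier G \<Longrightarrow> x \<in> points X \<Longrightarrow>
      twist X (\<tau>, \<rho>, x) * inverse (twist X (\<sigma> \<otimes> \<tau>, \<rho>, x))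
         * twist X (\<sigma>, \<tau> \<otimes> \<rho>, x) * inverse (twist X (\<sigma>, \<tau>, act X \<rho> x)) = 1"
  proof -
  have "\<forall>\<sigma> \<in> carrier G. \<forall>\<tau> \<in> carrier G. \<forall>x \<in> points X. \<sigma> = \<one> \<or> \<tau> = \<one> \<longrightarrow> twist X (\<sigma>, \<tau>, x) = 1"
    using assms by (simp add: is_obj_def)
  then show "\<tau> \<in> carrier G \<Longrightarrow> x \<in> points X \<Longrightarrow> twist X (\<one>, \<tau>, x) = 1"
      "\<sigma> \<in> carrier G \<Longrightarrow> x \<in> points X \<Longrightarrow> twist X (\<sigma>, \<one>, x) = 1"
    using one_closed by blast+
qed (use assms in \<open>auto simp: is_obj_def is_Gset_iff PiE_iff Pi_iff\<close>)

lemma twist_nonzero: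
  "is_obj X \<Longrightarrow> \<sigma> \<in> carrier G \<Longrightarrow> \<tau> \<in> carrier G \<Longrightarrow> x \<in> points X \<Longrightarrow> twist X (\<sigma>, \<tau>, x) \<noteq> 0"
  using norm_twist by fastforce

lemma is_cell1D:
  assumes "is_cell1 f"
  shows dom1_obj: "is_obj (dom1 f)"
    and cod1_obj: "is_obj (cod1 f)"
    and map1_closed: "x \<in> points (dom1 f) \<Longrightarrow> map1 f x \<in> points (cod1 f)"
    and map1_equivariant: "\<sigma> \<in> carrier G \<Longrightarrow> x \<in> points (dom1 f) \<Longrightarrow>
      map1 f (act (dom1 f) \<sigma> x) = act (cod1 f) \<sigma> (map1 f x)"
    and norm_cochain1: "\<sigma> \<in> carrier G \<Longrightarrow> x \<in> points (dom1 f) \<Longrightarrow> norm (cochain1 f (\<sigma>, x)) = 1"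
    and cochain1_one: "x \<in> points (dom1 f) \<Longrightarrow> cochain1 f (\<one>, x) = 1"
    and cochain1_coboundary: "\<sigma> \<in> carrier G \<Longrightarrow> \<tau> \<in> carrier G \<Longrightarrow> x \<in> points (dom1 f) \<Longrightarrow>
       cochain1 f (\<tau>, x) * inverse (cochain1 f (\<sigma> \<otimes> \<tau>, x)) * cochain1 f (\<sigma>, act (dom1 f) \<tau> x)
       = twist (cod1 f) (\<sigma>, \<tau>, map1 f x) * inverse (twist (dom1 f) (\<sigma>, \<tau>, x))"
  using assms by (auto simp: is_cell1_def PiE_iff Pi_iff)

section \<open>Values of structural cells and composites on the carriers\<close>

lemma tensor0_simps [simp]:
  "points (X \<boxtimes>\<^sub>0 Y) = points X \<times> points Y"
  "\<sigma> \<in> carrier G \<Longrightarrow> x \<in> points X \<Longrightarrow> y \<in> points Y \<Longrightarrow> act (X \<boxtimes>\<^sub>0 Y) \<sigma> (x, y) = (act X \<sigma> x, act Y \<sigma> y)"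
  "\<sigma> \<in> carrier G \<Longrightarrow> \<tau> \<in> carrier G \<Longrightarrow> x \<in> points X \<Longrightarrow> y \<in> points Y \<Longrightarrow>
    twist (X \<boxtimes>\<^sub>0 Y) (\<sigma>, \<tau>, x, y) = twist X (\<sigma>, \<tau>, x) * twist Y (\<sigma>, \<tau>, y)"
  by (simp_all add: tensor0_def)

lemma unit_obj_simps [simp]:
  "points \<^bold>I = UNIV"
  "\<sigma> \<in> carrier G \<Longrightarrow> act \<^bold>I \<sigma> x = x"
  "\<sigma> \<in> carrier G \<Longrightarrow> \<tau> \<in> carrier G \<Longrightarrow> twist \<^bold>I (\<sigma>, \<tau>, x) = 1"
  by (simp_all add: unit_obj_def)

lemma id1_simps [simp]:
  "dom1 (id1 X) = X" "cod1 (id1 X) = X"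
  "x \<in> points X \<Longrightarrow> map1 (id1 X) x = x"
  "\<sigma> \<in> carrier G \<Longrightarrow> x \<in> points X \<Longrightarrow> cochain1 (id1 X) (\<sigma>, x) = 1"
  by (simp_all add: id1_def)

lemma comp1_simps [simp]:
  "dom1 (g \<circ>\<^sub>1 f) = dom1 f" "cod1 (g \<circ>\<^sub>1 f) = cod1 g"
  "x \<in> points (dom1 f) \<Longrightarrow> map1 (g \<circ>\<^sub>1 f) x = map1 g (map1 f x)"
  "\<sigma> \<in> carrier G \<Longrightarrow> x \<in> points (dom1 f) \<Longrightarrow>
    cochain1 (g \<circ>\<^sub>1 f) (\<sigma>, x) = cochain1 g (\<sigma>, map1 f x) * cochain1 f (\<sigma>, x)"
  by (simp_all add: comp1_def)

lemma tensor1_simps [simp]: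
  "dom1 (f \<boxtimes>\<^sub>1 g) = dom1 f \<boxtimes>\<^sub>0 dom1 g" "cod1 (f \<boxtimes>\<^sub>1 g) = cod1 f \<boxtimes>\<^sub>0 cod1 g"
  "x \<in> points (dom1 f) \<Longrightarrow> y \<in> points (dom1 g) \<Longrightarrow> map1 (f \<boxtimes>\<^sub>1 g) (x, y) = (map1 f x, map1 g y)"
  "\<sigma> \<in> carrier G \<Longrightarrow> x \<in> points (dom1 f) \<Longrightarrow> y \<in> points (dom1 g) \<Longrightarrow>
    cochain1 (f \<boxtimes>\<^sub>1 g) (\<sigma>, x, y) = cochain1 f (\<sigma>, x) * cochain1 g (\<sigma>, y)"
  by (simp_all add: tensor1_def)

lemma assoc1_simps [simp]:
  "dom1 (assoc1 X Y Z) = (X \<boxtimes>\<^sub>0 Y) \<boxtimes>\<^sub>0 Z" "cod1 (assoc1 X Y Z) = X \<boxtimes>\<^sub>0 (Y \<boxtimes>\<^sub>0 Z)"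
  "x \<in> points X \<Longrightarrow> y \<in> points Y \<Longrightarrow> z \<in> points Z \<Longrightarrow> map1 (assoc1 X Y Z) ((x, y), z) = (x, (y, z))"
  "\<sigma> \<in> carrier G \<Longrightarrow> x \<in> points X \<Longrightarrow> y \<in> points Y \<Longrightarrow> z \<in> points Z \<Longrightarrow>
    cochain1 (assoc1 X Y Z) (\<sigma>, (x, y), z) = 1"
  by (simp_all add: assoc1_def)

lemma lunit1_simps [simp]:
  "dom1 (lunit1 X) = \<^bold>I \<boxtimes>\<^sub>0 X" "cod1 (lunit1 X) = X"
  "x \<in> points X \<Longrightarrow> map1 (lunit1 X) (u, x) = x"
  "\<sigma> \<in> carrier G \<Longrightarrow> x \<in> points X \<Longrightarrow> cochain1 (lunit1 X) (\<sigma>, u, x) = 1"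
  by (simp_all add: lunit1_def)

lemma runit1_simps [simp]:
  "dom1 (runit1 X) = X \<boxtimes>\<^sub>0 \<^bold>I" "cod1 (runit1 X) = X"
  "x \<in> points X \<Longrightarrow> map1 (runit1 X) (x, u) = x"
  "\<sigma> \<in> carrier G \<Longrightarrow> x \<in> points X \<Longrightarrow> cochain1 (runit1 X) (\<sigma>, x, u) = 1"
  by (simp_all add: runit1_def)

text \<open>Isolates the part of being a 1-cell that equality of records needs, so that composites
  can be compared before any coboundary condition is known for them.\<close>

definition extensional1 :: "('g, 'x, 'y) cell1 \<Rightarrow> bool"
  where "extensional1 f \<longleftrightarrow> map1 f \<in> extensional (points (dom1 f)) \<and>
    cochain1 f \<in> extensional (carrier G \<times> points (dom1 f))"

text \<open>All these cells are built by \<open>restrict\<close>, whatever their constituents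
  are.\<close>

lemma extensional1_simps [simp]:
  "extensional1 (g \<circ>\<^sub>1 f)" "extensional1 (h \<boxtimes>\<^sub>1 k)" "extensional1 (id1 X)"
  "extensional1 (assoc1 X Y Z)" "extensional1 (lunit1 X)" "extensional1 (runit1 X)"
  by (simp_all add: extensional1_def comp1_def tensor1_def id1_def assoc1_def lunit1_def runit1_def)

lemma cell1_eqI:
  assumes "extensional1 f" "extensional1 g" "dom1 f = dom1 g" "cod1 f = cod1 g"
    and "\<And>x. x \<in> points (dom1 g) \<Longrightarrow> map1 f x = map1 g x"
    and "\<And>\<sigma> x. \<sigma> \<in> carrier G \<Longrightarrow> x \<in> points (dom1 g) \<Longrightarrow> cochain1 f (\<sigma>, x) = cochain1 g (\<sigma>, x)"
  shows "f = g"
  by (rule cell1.equality)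
    (use assms in \<open>auto simp: extensional1_def intro: extensionalityI\<close>)

section \<open>Closure of objects and 1-cells under the operations\<close>

lemma is_obj_unit [simp]: "is_obj \<^bold>I"
  by (auto simp: is_obj_def is_Gset_iff unit_obj_def)

lemma is_obj_tensor0 [simp]:
  assumes "is_obj X" "is_obj Y"
  shows "is_obj (X \<boxtimes>\<^sub>0 Y)"
proof -
  have "twist (X \<boxtimes>\<^sub>0 Y) (\<tau>, \<rho>, z) * inverse (twist (X \<boxtimes>\<^sub>0 Y) (\<sigma> \<otimes> \<tau>, \<rho>, z))
      * twist (X \<boxtimes>\<^sub>0 Y) (\<sigma>, \<tau> \<otimes> \<rho>, z) * inverse (twist (X \<boxtimes>\<^sub>0 Y) (\<sigma>, \<tau>, act (X \<boxtimes>\<^sub>0 Y) \<rho> z)) = 1"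
    if "\<sigma> \<in> carrier G" "\<tau> \<in> carrier G" "\<rho> \<in> carrier G"
      and mem: "z \<in> points (X \<boxtimes>\<^sub>0 Y)" for \<sigma> \<tau> \<rho> z
  proof -
    obtain x y where z: "z = (x, y)" "x \<in> points X" "y \<in> points Y"
      using mem by auto
    show ?thesis
      \<comment> \<open>The action on the product is diagonal and the twists multiply, so the
        product of the two cocycle identities is the one wanted.\<close>
      using arg_cong2[where f = "(*)", OF twist_cocycle[OF assms(1) that(1-3) z(2)]
          twist_cocycle[OF assms(2) that(1-3) z(3)]] that z
      by (simp add: tensor0_def act_closed[OF assms(1)] act_closed[OF assms(2)] mult_ac)
  qed
  then show ?thesis
    using assms
    by (auto simp: is_obj_def is_Gset_iff tensor0_def PiE_iff Pi_iff norm_mult)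
qed

lemma is_cell1_id1 [simp]: "is_obj X \<Longrightarrow> is_cell1 (id1 X)"
  by (auto simp: is_cell1_def id1_def act_closed twist_nonzero)

lemma is_cell1_comp1:
  assumes "is_cell1 g" "is_cell1 f" "cod1 f = dom1 g"
  shows "is_cell1 (g \<circ>\<^sub>1 f)"
proof -
  note closed = act_closed[OF dom1_obj[OF assms(2)]] map1_closed[OF assms(2)]
  have "cochain1 (g \<circ>\<^sub>1 f) (\<tau>, x) * inverse (cochain1 (g \<circ>\<^sub>1 f) (\<sigma> \<otimes> \<tau>, x))
      * cochain1 (g \<circ>\<^sub>1 f) (\<sigma>, act (dom1 f) \<tau> x)
      = twist (cod1 g) (\<sigma>, \<tau>, map1 g (map1 f x)) * inverse (twist (dom1 f) (\<sigma>, \<tau>, x))"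
    if "\<sigma> \<in> carrier G" "\<tau> \<in> carrier G" "x \<in> points (dom1 f)" for \<sigma> \<tau> x
  proof -
    have "map1 f x \<in> points (dom1 g)"
      using that closed assms(3) by auto
    then show ?thesis
      \<comment> \<open>In the product of the two coboundary equations the twist of the middle
        object at \<open>map1 f x\<close> occurs once directly and once inverted; being nonzero, it
        cancels.\<close>
      using arg_cong2[where f = "(*)", OF cochain1_coboundary[OF assms(2) that]
          cochain1_coboundary[OF assms(1) that(1,2), of "map1 f x"]] that
        twist_nonzero[OF cod1_obj[OF assms(2)] that(1,2), of "map1 f x"]
      by (simp add: comp1_def closed assms(3) map1_equivariant[OF assms(2)] mult_ac)
  qed
  then show ?thesis
    using assms by (auto simp: is_cell1_def comp1_def closed PiE_iff Pi_iff norm_mult)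
qed

lemma is_cell1_tensor1:
  assumes "is_cell1 f" "is_cell1 g"
  shows "is_cell1 (f \<boxtimes>\<^sub>1 g)"
proof -
  note closed = act_closed[OF dom1_obj[OF assms(1)]] map1_closed[OF assms(1)]
    act_closed[OF dom1_obj[OF assms(2)]] map1_closed[OF assms(2)]
  have "cochain1 (f \<boxtimes>\<^sub>1 g) (\<tau>, x, y) * inverse (cochain1 (f \<boxtimes>\<^sub>1 g) (\<sigma> \<otimes> \<tau>, x, y))
      * cochain1 (f \<boxtimes>\<^sub>1 g) (\<sigma>, act (dom1 (f \<boxtimes>\<^sub>1 g)) \<tau> (x, y))
      = twist (cod1 (f \<boxtimes>\<^sub>1 g)) (\<sigma>, \<tau>, map1 (f \<boxtimes>\<^sub>1 g) (x, y))
        * inverse (twist (dom1 (f \<boxtimes>\<^sub>1 g)) (\<sigma>, \<tau>, x, y))"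
    if "\<sigma> \<in> carrier G" "\<tau> \<in> carrier G" "x \<in> points (dom1 f)" "y \<in> points (dom1 g)" for \<sigma> \<tau> x y
    using arg_cong2[where f = "(*)", OF cochain1_coboundary[OF assms(1) that(1,2,3)]
          cochain1_coboundary[OF assms(2) that(1,2,4)]] that
      by (simp add: tensor1_def tensor0_def closed mult_ac)
  then show ?thesis
    using assms unfolding is_cell1_def
    by (auto simp: tensor1_def closed PiE_iff Pi_iff norm_mult)
qed

text \<open>With cochain 1 the coboundary condition asks that the twist of the codomain pull back to
  that of the domain, which is associativity of a product of three twists.\<close>

lemma is_cell1_assoc1:
  "is_obj X \<Longrightarrow> is_obj Y \<Longrightarrow> is_obj Z \<Longrightarrow> is_cell1 (assoc1 X Y Z)"
  unfolding is_cell1_def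
  by (auto simp: assoc1_def act_closed twist_nonzero field_simps)

lemma is_cell1_lunit1: "is_obj X \<Longrightarrow> is_cell1 (lunit1 X)"
  unfolding is_cell1_def
  by (auto simp: lunit1_def act_closed twist_nonzero)

lemma is_cell1_runit1: "is_obj X \<Longrightarrow> is_cell1 (runit1 X)"
  unfolding is_cell1_def
  by (auto simp: runit1_def act_closed twist_nonzero)

end


section \<open>Low-degree differentials\<close>

lemma ball_nlists_0 : "(\<forall>xs \<in> nlists 0 A. Q xs) \<longleftrightarrow> Q []"
  by simp

lemma ball_nlists_Suc: "(\<forall>xs \<in> nlists (Suc n) A. Q xs) \<longleftrightarrow> (\<forall>x \<in> A. \<forall>xs \<in> nlists n A. Q (x # xs))"
  by (auto simp: in_nlists_Suc_iff)

text \<open>Splits a cochain equation on lists into one in separate variables. The first clause says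
  \<open>Suc 0\<close> because the simplifier rewrites \<open>1\<close> to that form.\<close>

lemma ball_nlists_numeral:
  "(\<forall>xs \<in> nlists (Suc 0) A. Q xs) \<longleftrightarrow> (\<forall>x \<in> A. Q [x])"
  "(\<forall>xs \<in> nlists 2 A. Q xs) \<longleftrightarrow> (\<forall>x \<in> A. \<forall>y \<in> A. Q [x, y])"
  "(\<forall>xs \<in> nlists 3 A. Q xs) \<longleftrightarrow> (\<forall>x \<in> A. \<forall>y \<in> A. \<forall>z \<in> A. Q [x, y, z])"
  "(\<forall>xs \<in> nlists 4 A. Q xs) \<longleftrightarrow> (\<forall>x \<in> A. \<forall>y \<in> A. \<forall>z \<in> A. \<forall>w \<in> A. Q [x, y, z, w])"
  by (simp_all only: eval_nat_numeral BitM.simps numeral_One One_nat_def ball_nlists_Suc ball_nlists_0)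

context discrete_group
begin

text \<open>The bidegrees are those of \<open>\<alpha>\<close>, \<open>\<beta>\<close> and
  \<open>\<theta>\<close>. The exponents \<open>(-1) ^ i\<close> become alternating inverses, as in
  the conditions on cells.\<close>

lemma delta_G_simps:
  shows "\<sigma> \<in> carrier G \<Longrightarrow> \<tau> \<in> carrier G \<Longrightarrow> \<rho> \<in> carrier G \<Longrightarrow> k \<in> carrier K \<Longrightarrow>
      delta_G K \<phi> 2 1 F ([\<sigma>, \<tau>, \<rho>], [k]) =
      F ([\<tau>, \<rho>], [k]) * inverse (F ([\<sigma> \<otimes> \<tau>, \<rho>], [k])) * F ([\<sigma>, \<tau> \<otimes> \<rho>], [k])
        * inverse (F ([\<sigma>, \<tau>], [\<phi> \<rho> k]))"
    and "\<sigma> \<in> carrier G \<Longrightarrow> \<tau> \<in> carrier G \<Longrightarrow> k \<in> carrier K \<Longrightarrow> l \<in> carrier K \<Longrightarrow>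
      delta_G K \<phi> 1 2 F ([\<sigma>, \<tau>], [k, l]) =
      F ([\<tau>], [k, l]) * inverse (F ([\<sigma> \<otimes> \<tau>], [k, l])) * F ([\<sigma>], [\<phi> \<tau> k, \<phi> \<tau> l])"
    and "\<sigma> \<in> carrier G \<Longrightarrow> k \<in> carrier K \<Longrightarrow> l \<in> carrier K \<Longrightarrow> n \<in> carrier K \<Longrightarrow>
      delta_G K \<phi> 0 3 F ([\<sigma>], [k, l, n]) =
      F ([], [k, l, n]) * inverse (F ([], [\<phi> \<sigma> k, \<phi> \<sigma> l, \<phi> \<sigma> n]))"
  by (simp_all add: delta_G_def contract_def eval_nat_numeral power_int_minus)

lemma delta_K_simps:
  shows "\<sigma> \<in> carrier G \<Longrightarrow> \<tau> \<in> carrier G \<Longrightarrow> k \<in> carrier K \<Longrightarrow> l \<in> carrier K \<Longrightarrow>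
      delta_K K 2 1 F ([\<sigma>, \<tau>], [k, l]) =
      F ([\<sigma>, \<tau>], [l]) * inverse (F ([\<sigma>, \<tau>], [k \<otimes>\<^bsub>K\<^esub> l])) * F ([\<sigma>, \<tau>], [k])"
    and "\<sigma> \<in> carrier G \<Longrightarrow> k \<in> carrier K \<Longrightarrow> l \<in> carrier K \<Longrightarrow> n \<in> carrier K \<Longrightarrow>
      delta_K K 1 2 F ([\<sigma>], [k, l, n]) =
      F ([\<sigma>], [l, n]) * inverse (F ([\<sigma>], [k \<otimes>\<^bsub>K\<^esub> l, n])) * F ([\<sigma>], [k, l \<otimes>\<^bsub>K\<^esub> n])
        * inverse (F ([\<sigma>], [k, l]))"
    and "k \<in> carrier K \<Longrightarrow> l \<in> carrier K \<Longrightarrow> n \<in> carrier K \<Longrightarrow> r \<in> carrier K \<Longrightarrow>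
      delta_K K 0 3 F ([], [k, l, n, r]) =
      F ([], [l, n, r]) * inverse (F ([], [k \<otimes>\<^bsub>K\<^esub> l, n, r])) * F ([], [k, l \<otimes>\<^bsub>K\<^esub> n, r])
        * inverse (F ([], [k, l, n \<otimes>\<^bsub>K\<^esub> r])) * F ([], [k, l, n])"
  by (simp_all add: delta_K_def contract_def eval_nat_numeral power_int_minus)

section \<open>The total cocycle condition in degree 3\<close>

lemma Tot_d_eq_Tot_one_iff:
  "Tot_d K \<phi> n c = Tot_one K (Suc n) \<longleftrightarrow>
   (\<forall>p \<le> Suc n. \<forall>gs \<in> nlists p (carrier G). \<forall>ks \<in> nlists (Suc n - p) (carrier K).
      (if p = 0 then 1 else delta_G K \<phi> (p - 1) (Suc n - p) (c (p - 1)) (gs, ks))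
      * (if p = Suc n then 1 else delta_K K p (n - p) (c p) (gs, ks) powi ((-1) ^ p)) = 1)"
  (is "_ \<longleftrightarrow> (\<forall>p \<le> Suc n. \<forall>gs \<in> ?A p. \<forall>ks \<in> ?B p. ?d p gs ks = 1)")
proof
  assume eq: "Tot_d K \<phi> n c = Tot_one K (Suc n)"
  show "\<forall>p \<le> Suc n. \<forall>gs \<in> ?A p. \<forall>ks \<in> ?B p. ?d p gs ks = 1"
  proof (intro allI impI ballI)
    fix p gs ks
    assume "p \<le> Suc n" "gs \<in> ?A p" "ks \<in> ?B p"
    then show "?d p gs ks = 1"
      using fun_cong[OF fun_cong[OF eq, of p], of "(gs, ks)"]
      by (simp only: Tot_d_def Tot_one_def one_cochain_def restrict_apply' atMost_iff mem_Times_iff fst_conv snd_conv simp_thms)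
  qed
next
  assume *: "\<forall>p \<le> Suc n. \<forall>gs \<in> ?A p. \<forall>ks \<in> ?B p. ?d p gs ks = 1"
  show "Tot_d K \<phi> n c = Tot_one K (Suc n)"
    unfolding Tot_d_def Tot_one_def one_cochain_def
    by (intro restrict_ext) (use * in blast)
qed

text \<open>The bidegrees \<open>(p, 4 - p)\<close> give five conditions. The one in
  \<open>(4, 0)\<close> involves only the constant entry of bidegree \<open>(3, 0)\<close>, and in
  \<open>(3, 1)\<close> that entry contributes a factor 1, so four remain. Among these the sign
  \<open>(-1) ^ p\<close> leaves a visible inverse only at \<open>p = 1\<close>.\<close>

lemma Tot_cocycle_3_iff:
  assumes closed: "\<And>k l. k \<in> carrier K \<Longrightarrow> l \<in> carrier K \<Longrightarrow> k \<otimes>\<^bsub>K\<^esub> l \<in> carrier K"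
    and act: "\<And>g k. g \<in> carrier G \<Longrightarrow> k \<in> carrier K \<Longrightarrow> \<phi> g k \<in> carrier K"
    and \<alpha>: "\<alpha> \<in> cochains K 2 1" and \<beta>: "\<beta> \<in> cochains K 1 2" and \<theta>: "\<theta> \<in> cochains K 0 3"
  shows "Tot_cocycle K \<phi> 3 (direct_sum3 K \<alpha> \<beta> \<theta>) \<longleftrightarrow>
    (\<forall>\<sigma> \<in> carrier G. \<forall>\<tau> \<in> carrier G. \<forall>\<rho> \<in> carrier G. \<forall>k \<in> carrier K.
      delta_G K \<phi> 2 1 \<alpha> ([\<sigma>, \<tau>, \<rho>], [k]) = 1) \<and>
    (\<forall>\<sigma> \<in> carrier G. \<forall>\<tau> \<in> carrier G. \<forall>k \<in> carrier K. \<forall>l \<in> carrier K.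
      delta_G K \<phi> 1 2 \<beta> ([\<sigma>, \<tau>], [k, l]) * delta_K K 2 1 \<alpha> ([\<sigma>, \<tau>], [k, l]) = 1) \<and>
    (\<forall>\<sigma> \<in> carrier G. \<forall>k \<in> carrier K. \<forall>l \<in> carrier K. \<forall>n \<in> carrier K.
      delta_G K \<phi> 0 3 \<theta> ([\<sigma>], [k, l, n]) * inverse (delta_K K 1 2 \<beta> ([\<sigma>], [k, l, n])) = 1) \<and>
    (\<forall>k \<in> carrier K. \<forall>l \<in> carrier K. \<forall>n \<in> carrier K. \<forall>r \<in> carrier K.
      delta_K K 0 3 \<theta> ([], [k, l, n, r]) = 1)"
proof -
  let ?c = "direct_sum3 K \<alpha> \<beta> \<theta>"
  have c: "?c 0 = \<theta>" "?c (Suc 0) = \<beta>" "?c 2 = \<alpha>" "?c 3 = one_cochain K 3 0"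
    by (simp_all add: direct_sum3_def)
  have all: "(\<forall>p \<le> Suc 3. Q p) \<longleftrightarrow> Q 0 \<and> Q 1 \<and> Q 2 \<and> Q 3 \<and> Q 4" for Q :: "nat \<Rightarrow> bool"
    by (auto simp: le_Suc_eq numeral_eq_Suc)
  have Tot: "?c \<in> Tot K 3"
  proof -
    have "?c p \<in> A_cochains K p (3 - p)" if "p \<le> 3" for p
    proof -
      \<comment> \<open>For \<open>p = 3\<close> the row \<open>q = 0\<close> of
        \<open>A_cochains\<close> is the singleton of the constant cochain; the other cases are the
        three hypotheses.\<close>
      consider "p = 0" | "p = Suc 0" | "p = 2" | "p = 3"
        using \<open>p \<le> 3\<close> by linarith
      then show ?thesis
        using \<alpha> \<beta> \<theta> by cases (simp_all add: A_cochains_def c)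
    qed
    then show ?thesis
      by (auto simp: Tot_def direct_sum3_def)
  qed
  have one_G: "delta_G K \<phi> 3 0 (one_cochain K 3 0) ([\<sigma>, \<tau>, \<rho>, \<upsilon>], []) = 1"
    if "\<sigma> \<in> carrier G" "\<tau> \<in> carrier G" "\<rho> \<in> carrier G" "\<upsilon> \<in> carrier G" for \<sigma> \<tau> \<rho> \<upsilon>
    using that by (simp add: delta_G_def one_cochain_def contract_def eval_nat_numeral)
  have one_K: "delta_K K 3 0 (one_cochain K 3 0) ([\<sigma>, \<tau>, \<rho>], [k]) = 1"
    if "\<sigma> \<in> carrier G" "\<tau> \<in> carrier G" "\<rho> \<in> carrier G" "k \<in> carrier K" for \<sigma> \<tau> \<rho> k
    using that by (simp add: delta_K_def one_cochain_def eval_nat_numeral)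
  \<comment> \<open>Degree arguments of the differentials at \<open>n = 3\<close>, brought to the
    numerals in which the other rules are stated.\<close>
  have minus: "Suc 3 - 0 = (4::nat)" "Suc 3 - Suc 0 = 3" "Suc 3 - 2 = (2::nat)" "Suc 3 - 3 = Suc 0" "Suc 3 - 4 = (0::nat)"
    "3 - 0 = (3::nat)" "3 - Suc 0 = (2::nat)" "3 - 2 = Suc 0" "3 - 3 = (0::nat)"
    "2 - Suc 0 = Suc 0" "4 - Suc 0 = 3"
    by simp_all
  show ?thesis
    unfolding Tot_cocycle_def Tot_d_eq_Tot_one_iff all
    by (simp add: Tot minus c one_G one_K ball_nlists_numeral ball_nlists_0 power_int_minus; blast)
qed

end


section \<open>Strictly unital pseudomonoids\<close>

lemma restrict_eq_restrict_iff: "restrict f A = restrict g A \<longleftrightarrow> (\<forall>x \<in> A. f x = g x)"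
  by (metis restrict_apply' restrict_ext)

context discrete_group
begin

text \<open>Circle values are nonzero, so the pointwise inverse cochain is a 2-cell in the other
  direction. The isomorphism conditions in \<open>is_pseudomonoid\<close> thus reduce to being a
  2-cell.\<close>

lemma is_iso2_iff: "is_iso2 t \<longleftrightarrow> is_cell2 t"
proof
  assume t: "is_cell2 t"
  let ?s = "\<lparr>src2 = tgt2 t, tgt2 = src2 t,
    cochain2 = (\<lambda>x \<in> points (dom1 (src2 t)). inverse (cochain2 t x))\<rparr>"
  have norm: "norm (cochain2 t x) = 1" if "x \<in> points (dom1 (src2 t))" for x
    using t that by (auto simp: is_cell2_def)
  then have nonzero: "cochain2 t x \<noteq> 0" if "x \<in> points (dom1 (src2 t))" for x
    using that by fastforce
  have "inverse (cochain2 t x) * cochain2 t (act (dom1 (src2 t)) \<sigma> x)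
      = cochain1 (src2 t) (\<sigma>, x) * inverse (cochain1 (tgt2 t) (\<sigma>, x))"
    if "\<sigma> \<in> carrier G" "x \<in> points (dom1 (src2 t))" for \<sigma> x
  proof -
    have "cochain2 t x * inverse (cochain2 t (act (dom1 (src2 t)) \<sigma> x))
       = cochain1 (tgt2 t) (\<sigma>, x) * inverse (cochain1 (src2 t) (\<sigma>, x))"
      using t that by (auto simp: is_cell2_def)
    \<comment> \<open>Inverting the equation for \<open>t\<close> exchanges its source and target,
      which is the equation required of \<open>?s\<close>.\<close>
    from arg_cong[OF this, of inverse] show ?thesis
      by (simp add: mult.commute)
  qed
  then have "is_cell2 ?s"
    using t norm dom1_obj[of "src2 t"] unfolding is_cell2_def
    by (auto simp: act_closed norm_inverse)
  moreover have "?s \<circ>\<^sub>v t = id2 (src2 t)" "t \<circ>\<^sub>v ?s = id2 (tgt2 t)"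
    using t nonzero by (auto simp: vcomp_def id2_def is_cell2_def intro!: restrict_ext)
  ultimately show "is_iso2 t"
    using t unfolding is_iso2_def by (intro conjI exI[of _ ?s]) auto
qed (simp add: is_iso2_def)

lemma is_cell2_id2:
  assumes "is_cell1 f"
  shows "is_cell2 (id2 f)"
proof -
  have "cochain1 f (\<sigma>, x) \<noteq> 0" if "\<sigma> \<in> carrier G" "x \<in> points (dom1 f)" for \<sigma> x
    using norm_cochain1[OF assms that] by auto
  then show ?thesis
    using assms act_closed[OF dom1_obj[OF assms]] by (simp add: is_cell2_def id2_def)
qed

section \<open>Normal form of strictly unital pseudomonoids\<close>

definition mul_cell ::
  "('g, 'k) tw_set \<Rightarrow> ('k \<times> 'k \<Rightarrow> 'k) \<Rightarrow> ('g \<times> 'k \<times> 'k \<Rightarrow> complex) \<Rightarrow> ('g, 'k \<times> 'k, 'k) cell1"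
  where "mul_cell C m \<beta> = \<lparr>dom1 = C \<boxtimes>\<^sub>0 C, cod1 = C, map1 = m, cochain1 = \<beta>\<rparr>"

definition unit_cell :: "('g, 'k) tw_set \<Rightarrow> 'k \<Rightarrow> ('g, unit, 'k) cell1"
  where "unit_cell C e =
    \<lparr>dom1 = \<^bold>I, cod1 = C, map1 = (\<lambda>_. e), cochain1 = (\<lambda>_ \<in> carrier G \<times> UNIV. 1)\<rparr>"

text \<open>The five parameters are exactly what a strict unit leaves free. The cochains take tuples
  here, as in the cells; the passage to lists is made separately.\<close>

definition strict_pseudomon ::
  "('g, 'k) tw_set \<Rightarrow> ('k \<times> 'k \<Rightarrow> 'k) \<Rightarrow> 'k \<Rightarrow> ('g \<times> 'k \<times> 'k \<Rightarrow> complex) \<Rightarrow>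
    (('k \<times> 'k) \<times> 'k \<Rightarrow> complex) \<Rightarrow> ('g, 'k) pseudomon"
  where "strict_pseudomon C m e \<beta> \<theta> =
    \<lparr>obj = C, mul = mul_cell C m \<beta>, unt = unit_cell C e,
     assoc2 = \<lparr>src2 = mul_cell C m \<beta> \<circ>\<^sub>1 (mul_cell C m \<beta> \<boxtimes>\<^sub>1 id1 C),
               tgt2 = mul_cell C m \<beta> \<circ>\<^sub>1 (id1 C \<boxtimes>\<^sub>1 mul_cell C m \<beta>) \<circ>\<^sub>1 assoc1 C C C,
               cochain2 = \<theta>\<rparr>,
     lunit2 = id2 (lunit1 C), runit2 = id2 (runit1 C)\<rparr>"

lemma mul_cell_simps [simp]:
  "dom1 (mul_cell C m \<beta>) = C \<boxtimes>\<^sub>0 C" "cod1 (mul_cell C m \<beta>) = C"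
  "map1 (mul_cell C m \<beta>) = m" "cochain1 (mul_cell C m \<beta>) = \<beta>"
  by (simp_all add: mul_cell_def)

lemma unit_cell_simps [simp]:
  "dom1 (unit_cell C e) = \<^bold>I" "cod1 (unit_cell C e) = C" "map1 (unit_cell C e) u = e"
  "\<sigma> \<in> carrier G \<Longrightarrow> cochain1 (unit_cell C e) (\<sigma>, u) = 1"
  by (simp_all add: unit_cell_def)

lemma strict_pseudomon_simps [simp]:
  "obj (strict_pseudomon C m e \<beta> \<theta>) = C"
  "mul (strict_pseudomon C m e \<beta> \<theta>) = mul_cell C m \<beta>"
  "unt (strict_pseudomon C m e \<beta> \<theta>) = unit_cell C e"
  "src2 (assoc2 (strict_pseudomon C m e \<beta> \<theta>)) = mul_cell C m \<beta> \<circ>\<^sub>1 (mul_cell C m \<beta> \<boxtimes>\<^sub>1 id1 C)"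
  "tgt2 (assoc2 (strict_pseudomon C m e \<beta> \<theta>)) =
    mul_cell C m \<beta> \<circ>\<^sub>1 (id1 C \<boxtimes>\<^sub>1 mul_cell C m \<beta>) \<circ>\<^sub>1 assoc1 C C C"
  "cochain2 (assoc2 (strict_pseudomon C m e \<beta> \<theta>)) = \<theta>"
  "lunit2 (strict_pseudomon C m e \<beta> \<theta>) = id2 (lunit1 C)"
  "runit2 (strict_pseudomon C m e \<beta> \<theta>) = id2 (runit1 C)"
  by (simp_all add: strict_pseudomon_def)

lemma id2_simps [simp]: "src2 (id2 f) = f" "tgt2 (id2 f) = f"
  by (simp_all add: id2_def)

text \<open>The axioms prescribe all sources and targets, and the strict unit prescribes the
  cochains of \<open>unt P\<close>, \<open>lunit2 P\<close> and \<open>runit2 P\<close>, so only the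
  five parameters can vary.\<close>

lemma eq_strict_pseudomon:
  assumes "is_pseudomonoid P" "has_strict_unit P"
  shows "P = strict_pseudomon (obj P) (map1 (mul P)) (map1 (unt P) ()) (cochain1 (mul P)) (cochain2 (assoc2 P))"
proof -
  have mul: "mul P = mul_cell (obj P) (map1 (mul P)) (cochain1 (mul P))"
    and unt: "unt P = unit_cell (obj P) (map1 (unt P) ())"
    using assms
    by (auto simp: is_pseudomonoid_def has_strict_unit_def Let_def mul_cell_def unit_cell_def intro: cell1.equality)
  \<comment> \<open>An identity 2-cell has equal source and target, and the targets are known to be
    \<open>lunit1\<close> and \<open>runit1\<close>.\<close>
  have "tgt2 (lunit2 P) = src2 (lunit2 P)" "tgt2 (runit2 P) = src2 (runit2 P)"
    using assms id2_simps by (metis has_strict_unit_def)+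
  then have "lunit2 P = id2 (lunit1 (obj P))" "runit2 P = id2 (runit1 (obj P))"
    using assms unfolding is_pseudomonoid_def has_strict_unit_def Let_def by metis+
  moreover have "assoc2 P = assoc2 (strict_pseudomon (obj P) (map1 (mul P)) (map1 (unt P) ()) (cochain1 (mul P)) (cochain2 (assoc2 P)))"
    using assms
    by (auto simp: is_pseudomonoid_def Let_def simp flip: mul intro: cell2.equality)
  ultimately show ?thesis
    using mul unt by (auto intro: pseudomon.equality)
qed

text \<open>All pseudomonoid axioms written pointwise. Only the normalizations given directly by the
  axioms are listed; those of \<open>\<theta>\<close> in the outer variables are derived
  later.\<close>

definition strict_pseudomon_data ::
  "('g, 'k) tw_set \<Rightarrow> ('k \<times> 'k \<Rightarrow> 'k) \<Rightarrow> 'k \<Rightarrow> ('g \<times> 'k \<times> 'k \<Rightarrow> complex) \<Rightarrow>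
    (('k \<times> 'k) \<times> 'k \<Rightarrow> complex) \<Rightarrow> bool"
  where "strict_pseudomon_data C m e \<beta> \<theta> \<longleftrightarrow>
    (let K = points C; \<phi> = act C; \<alpha> = twist C in
      is_obj C \<and>
      m \<in> K \<times> K \<rightarrow>\<^sub>E K \<and> e \<in> K \<and>
      (\<forall>k \<in> K. \<forall>l \<in> K. \<forall>n \<in> K. m (m (k, l), n) = m (k, m (l, n))) \<and>
      (\<forall>k \<in> K. m (e, k) = k) \<and> (\<forall>k \<in> K. m (k, e) = k) \<and>
      (\<forall>\<sigma> \<in> carrier G. \<forall>k \<in> K. \<forall>l \<in> K. m (\<phi> \<sigma> k, \<phi> \<sigma> l) = \<phi> \<sigma> (m (k, l))) \<and>
      (\<forall>\<sigma> \<in> carrier G. \<phi> \<sigma> e = e) \<and>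
      (\<forall>\<sigma> \<in> carrier G. \<forall>\<tau> \<in> carrier G. \<alpha> (\<sigma>, \<tau>, e) = 1) \<and>
      \<beta> \<in> carrier G \<times> K \<times> K \<rightarrow>\<^sub>E circle \<and>
      (\<forall>k \<in> K. \<forall>l \<in> K. \<beta> (\<one>, k, l) = 1) \<and>
      (\<forall>\<sigma> \<in> carrier G. \<forall>k \<in> K. \<beta> (\<sigma>, e, k) = 1) \<and>
      (\<forall>\<sigma> \<in> carrier G. \<forall>k \<in> K. \<beta> (\<sigma>, k, e) = 1) \<and>
      (\<forall>\<sigma> \<in> carrier G. \<forall>\<tau> \<in> carrier G. \<forall>k \<in> K. \<forall>l \<in> K.
        \<beta> (\<tau>, k, l) * inverse (\<beta> (\<sigma> \<otimes> \<tau>, k, l)) * \<beta> (\<sigma>, \<phi> \<tau> k, \<phi> \<tau> l)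
        = \<alpha> (\<sigma>, \<tau>, m (k, l)) * inverse (\<alpha> (\<sigma>, \<tau>, k) * \<alpha> (\<sigma>, \<tau>, l))) \<and>
      \<theta> \<in> (K \<times> K) \<times> K \<rightarrow>\<^sub>E circle \<and>
      (\<forall>k \<in> K. \<forall>l \<in> K. \<theta> ((k, e), l) = 1) \<and>
      (\<forall>\<sigma> \<in> carrier G. \<forall>k \<in> K. \<forall>l \<in> K. \<forall>n \<in> K.
        \<theta> ((k, l), n) * inverse (\<theta> ((\<phi> \<sigma> k, \<phi> \<sigma> l), \<phi> \<sigma> n))
        = \<beta> (\<sigma>, k, m (l, n)) * \<beta> (\<sigma>, l, n) * inverse (\<beta> (\<sigma>, m (k, l), n) * \<beta> (\<sigma>, k, l))) \<and>
      (\<forall>k \<in> K. \<forall>l \<in> K. \<forall>n \<in> K. \<forall>r \<in> K.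
        \<theta> ((k, l), m (n, r)) * \<theta> ((m (k, l), n), r)
        = \<theta> ((l, n), r) * \<theta> ((k, m (l, n)), r) * \<theta> ((k, l), n)))"

lemma is_cell1_mul_cell_iff:
  assumes "is_obj C"
  shows "is_cell1 (mul_cell C m \<beta>) \<longleftrightarrow>
    m \<in> points C \<times> points C \<rightarrow>\<^sub>E points C \<and>
    (\<forall>\<sigma> \<in> carrier G. \<forall>k \<in> points C. \<forall>l \<in> points C. m (act C \<sigma> k, act C \<sigma> l) = act C \<sigma> (m (k, l))) \<and>
    \<beta> \<in> carrier G \<times> points C \<times> points C \<rightarrow>\<^sub>E circle \<and>
    (\<forall>k \<in> points C. \<forall>l \<in> points C. \<beta> (\<one>, k, l) = 1) \<and>
    (\<forall>\<sigma> \<in> carrier G. \<forall>\<tau> \<in> carrier G. \<forall>k \<in> points C. \<forall>l \<in> points C.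
      \<beta> (\<tau>, k, l) * inverse (\<beta> (\<sigma> \<otimes> \<tau>, k, l)) * \<beta> (\<sigma>, act C \<tau> k, act C \<tau> l)
      = twist C (\<sigma>, \<tau>, m (k, l)) * inverse (twist C (\<sigma>, \<tau>, k) * twist C (\<sigma>, \<tau>, l)))"
  using assms by (simp add: is_cell1_def)

text \<open>The twist of the unit object and the cochain are both 1, so the coboundary condition
  says that \<open>twist C\<close> is 1 at \<open>e\<close>: this is the normalization of
  \<open>\<alpha>\<close> in its monoid variable.\<close>

lemma is_cell1_unit_cell_iff:
  assumes "is_obj C"
  shows "is_cell1 (unit_cell C e) \<longleftrightarrow> e \<in> points C \<and> (\<forall>\<sigma> \<in> carrier G. act C \<sigma> e = e) \<and>
    (\<forall>\<sigma> \<in> carrier G. \<forall>\<tau> \<in> carrier G. twist C (\<sigma>, \<tau>, e) = 1)"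
  using assms by (auto simp: is_cell1_def unit_cell_def)

section \<open>Unit laws, triangle, associator and pentagon as pointwise equations\<close>

context
  fixes C :: "('g, 'k) tw_set" and m :: "'k \<times> 'k \<Rightarrow> 'k" and e :: 'k
    and \<beta> :: "'g \<times> 'k \<times> 'k \<Rightarrow> complex" and \<theta> :: "('k \<times> 'k) \<times> 'k \<Rightarrow> complex"
  assumes closed: "\<forall>x \<in> points C. \<forall>y \<in> points C. m (x, y) \<in> points C"
    and unit_closed: "e \<in> points C"
begin

private abbreviation (input) "M \<equiv> mul_cell C m \<beta>"
private abbreviation (input) "U \<equiv> unit_cell C e"
private abbreviation (input) "Q \<equiv> strict_pseudomon C m e \<beta> \<theta>"
private abbreviation (input) "I \<equiv> id1 C"

text \<open>\<open>vcomp\<close> keeps only the outer source and target. These agree on both sides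
  by \<open>src\<close> and \<open>tgt\<close>, with underlying maps
  \<open>m (m (m (k, l), n), r)\<close> and \<open>m (k, m (l, m (n, r)))\<close>, so only the
  equality of cochains is left.\<close>

lemma pentagon_strict_pseudomon_iff:
  "pentagon Q \<longleftrightarrow>
    (\<forall>k \<in> points C. \<forall>l \<in> points C. \<forall>n \<in> points C. \<forall>r \<in> points C.
      \<theta> ((k, l), m (n, r)) * \<theta> ((m (k, l), n), r)
      = \<theta> ((l, n), r) * \<theta> ((k, m (l, n)), r) * \<theta> ((k, l), n))"
proof -
  have src: "M \<circ>\<^sub>1 ((M \<circ>\<^sub>1 (M \<boxtimes>\<^sub>1 I)) \<boxtimes>\<^sub>1 I) = (M \<circ>\<^sub>1 (M \<boxtimes>\<^sub>1 I)) \<circ>\<^sub>1 ((M \<boxtimes>\<^sub>1 I) \<boxtimes>\<^sub>1 I)"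
    by (rule cell1_eqI) (auto simp: closed)
  have tgt: "(M \<circ>\<^sub>1 (I \<boxtimes>\<^sub>1 (M \<circ>\<^sub>1 (I \<boxtimes>\<^sub>1 M) \<circ>\<^sub>1 assoc1 C C C)))
      \<circ>\<^sub>1 (assoc1 C (C \<boxtimes>\<^sub>0 C) C \<circ>\<^sub>1 (assoc1 C C C \<boxtimes>\<^sub>1 I))
    = (M \<circ>\<^sub>1 (I \<boxtimes>\<^sub>1 M) \<circ>\<^sub>1 assoc1 C C C) \<circ>\<^sub>1 (((I \<boxtimes>\<^sub>1 I) \<boxtimes>\<^sub>1 M) \<circ>\<^sub>1 assoc1 (C \<boxtimes>\<^sub>0 C) C C)"
    by (rule cell1_eqI) (auto simp: closed mult_ac)
  show ?thesis
    unfolding pentagon_def Let_def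
    by (simp add: vcomp_def whisker_pre_def whisker_post_def tensor2_def id2_def src tgt
        restrict_eq_restrict_iff closed mult.assoc)
qed

text \<open>If \<open>\<ell>\<close> is an identity, its prescribed source and target coincide. The
  map component of this equality is the left unit law, the cochain component a normalization of
  \<open>\<beta>\<close>.\<close>

lemma mul_lunit_eq_lunit1_iff:
  "M \<circ>\<^sub>1 (U \<boxtimes>\<^sub>1 I) = lunit1 C \<longleftrightarrow>
    (\<forall>x \<in> points C. m (e, x) = x) \<and> (\<forall>\<sigma> \<in> carrier G. \<forall>x \<in> points C. \<beta> (\<sigma>, e, x) = 1)"
proof
  assume eq: "M \<circ>\<^sub>1 (U \<boxtimes>\<^sub>1 I) = lunit1 C"
  have "m (e, x) = x" if "x \<in> points C" for x
    using arg_cong[OF eq, of "\<lambda>f. map1 f ((), x)"] that by simp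
  moreover have "\<beta> (\<sigma>, e, x) = 1" if "\<sigma> \<in> carrier G" "x \<in> points C" for \<sigma> x
    using arg_cong[OF eq, of "\<lambda>f. cochain1 f (\<sigma>, (), x)"] that by simp
  ultimately show "(\<forall>x \<in> points C. m (e, x) = x) \<and>
      (\<forall>\<sigma> \<in> carrier G. \<forall>x \<in> points C. \<beta> (\<sigma>, e, x) = 1)"
    by blast
next
  assume "(\<forall>x \<in> points C. m (e, x) = x) \<and> (\<forall>\<sigma> \<in> carrier G. \<forall>x \<in> points C. \<beta> (\<sigma>, e, x) = 1)"
  then show "M \<circ>\<^sub>1 (U \<boxtimes>\<^sub>1 I) = lunit1 C"
    by (intro cell1_eqI) auto
qed

lemma mul_runit_eq_runit1_iff:
  "M \<circ>\<^sub>1 (I \<boxtimes>\<^sub>1 U) = runit1 C \<longleftrightarrow>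
    (\<forall>x \<in> points C. m (x, e) = x) \<and> (\<forall>\<sigma> \<in> carrier G. \<forall>x \<in> points C. \<beta> (\<sigma>, x, e) = 1)"
proof
  assume eq: "M \<circ>\<^sub>1 (I \<boxtimes>\<^sub>1 U) = runit1 C"
  have "m (x, e) = x" if "x \<in> points C" for x
    using arg_cong[OF eq, of "\<lambda>f. map1 f (x, ())"] that by simp
  moreover have "\<beta> (\<sigma>, x, e) = 1" if "\<sigma> \<in> carrier G" "x \<in> points C" for \<sigma> x
    using arg_cong[OF eq, of "\<lambda>f. cochain1 f (\<sigma>, x, ())"] that by simp
  ultimately show "(\<forall>x \<in> points C. m (x, e) = x) \<and>
      (\<forall>\<sigma> \<in> carrier G. \<forall>x \<in> points C. \<beta> (\<sigma>, x, e) = 1)"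
    by blast
next
  assume "(\<forall>x \<in> points C. m (x, e) = x) \<and> (\<forall>\<sigma> \<in> carrier G. \<forall>x \<in> points C. \<beta> (\<sigma>, x, e) = 1)"
  then show "M \<circ>\<^sub>1 (I \<boxtimes>\<^sub>1 U) = runit1 C"
    by (intro cell1_eqI) auto
qed

text \<open>Under these hypotheses the outer sources and targets of both sides all equal
  \<open>M \<circ>\<^sub>1 (runit1 C \<boxtimes>\<^sub>1 I)\<close>. Since the unit 2-cells have
  cochain 1, only the value of \<open>\<theta>\<close> at the inserted unit survives.\<close>

lemma triangle_strict_pseudomon_iff:
  assumes "\<And>x. x \<in> points C \<Longrightarrow> m (e, x) = x" "\<And>x. x \<in> points C \<Longrightarrow> m (x, e) = x"
    and "\<And>\<sigma> x. \<sigma> \<in> carrier G \<Longrightarrow> x \<in> points C \<Longrightarrow> \<beta> (\<sigma>, e, x) = 1"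
    and "\<And>\<sigma> x. \<sigma> \<in> carrier G \<Longrightarrow> x \<in> points C \<Longrightarrow> \<beta> (\<sigma>, x, e) = 1"
  shows "triangle Q \<longleftrightarrow> (\<forall>k \<in> points C. \<forall>l \<in> points C. \<theta> ((k, e), l) = 1)"
proof -
  have src: "(M \<circ>\<^sub>1 (M \<boxtimes>\<^sub>1 I)) \<circ>\<^sub>1 ((I \<boxtimes>\<^sub>1 U) \<boxtimes>\<^sub>1 I) = M \<circ>\<^sub>1 (runit1 C \<boxtimes>\<^sub>1 I)"
    by (rule cell1_eqI) (auto simp: assms unit_closed)
  have tgt: "(M \<circ>\<^sub>1 (I \<boxtimes>\<^sub>1 lunit1 C)) \<circ>\<^sub>1 assoc1 C \<^bold>I C = M \<circ>\<^sub>1 (runit1 C \<boxtimes>\<^sub>1 I)"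
    by (rule cell1_eqI) auto
  show ?thesis
    unfolding triangle_def Let_def
    by (simp add: vcomp_def whisker_pre_def whisker_post_def tensor2_def id2_def src tgt
        restrict_eq_restrict_iff closed unit_closed)
qed

text \<open>A 2-cell joins 1-cells with the same underlying map; this is where strict associativity
  of \<open>m\<close> comes from. The last condition is the 2-cell equation for
  \<open>\<theta>\<close>.\<close>

lemma is_cell2_assoc2_iff:
  assumes "is_obj C" "is_cell1 M"
  shows "is_cell2 (assoc2 Q) \<longleftrightarrow>
    (\<forall>k \<in> points C. \<forall>l \<in> points C. \<forall>n \<in> points C. m (m (k, l), n) = m (k, m (l, n))) \<and>
    \<theta> \<in> (points C \<times> points C) \<times> points C \<rightarrow>\<^sub>E circle \<and>
    (\<forall>\<sigma> \<in> carrier G. \<forall>k \<in> points C. \<forall>l \<in> points C. \<forall>n \<in> points C.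
        \<theta> ((k, l), n) * inverse (\<theta> ((act C \<sigma> k, act C \<sigma> l), act C \<sigma> n))
        = \<beta> (\<sigma>, k, m (l, n)) * \<beta> (\<sigma>, l, n) * inverse (\<beta> (\<sigma>, m (k, l), n) * \<beta> (\<sigma>, k, l)))"
proof -
  have cells: "is_cell1 (M \<circ>\<^sub>1 (M \<boxtimes>\<^sub>1 I))" "is_cell1 (M \<circ>\<^sub>1 (I \<boxtimes>\<^sub>1 M) \<circ>\<^sub>1 assoc1 C C C)"
    using assms by (auto intro!: is_cell1_comp1 is_cell1_tensor1 is_cell1_assoc1)
  have map: "map1 (M \<circ>\<^sub>1 (M \<boxtimes>\<^sub>1 I)) = map1 (M \<circ>\<^sub>1 (I \<boxtimes>\<^sub>1 M) \<circ>\<^sub>1 assoc1 C C C) \<longleftrightarrow>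
    (\<forall>k \<in> points C. \<forall>l \<in> points C. \<forall>n \<in> points C. m (m (k, l), n) = m (k, m (l, n)))"
    unfolding comp1_def by (simp add: restrict_eq_restrict_iff closed)
  show ?thesis
    unfolding is_cell2_def using cells by (simp add: map closed act_closed[OF assms(1)])
qed

end

lemma is_pseudomonoid_strict_pseudomon_iff:
  "is_pseudomonoid (strict_pseudomon C m e \<beta> \<theta>) \<longleftrightarrow> strict_pseudomon_data C m e \<beta> \<theta>"
  (is "is_pseudomonoid ?P \<longleftrightarrow> ?R")
\<comment> \<open>The pointwise equivalences are available only if \<open>C\<close> is an object and
  the multiplication and the unit are 1-cells. Otherwise both sides are false.\<close>
proof (cases "is_obj C \<and> is_cell1 (mul_cell C m \<beta>) \<and> is_cell1 (unit_cell C e)")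
  case True
  then have obj: "is_obj C" and mul: "is_cell1 (mul_cell C m \<beta>)" and unt: "is_cell1 (unit_cell C e)"
    by auto
  have closed: "\<forall>x \<in> points C. \<forall>y \<in> points C. m (x, y) \<in> points C"
    using mul by (auto simp: is_cell1_mul_cell_iff[OF obj])
  have e: "e \<in> points C"
    using unt by (simp add: is_cell1_unit_cell_iff[OF obj])
  note iffs = mul_lunit_eq_lunit1_iff[OF closed e] mul_runit_eq_runit1_iff[OF closed e]
    triangle_strict_pseudomon_iff[OF closed e] pentagon_strict_pseudomon_iff[OF closed e]
    is_cell2_assoc2_iff[OF closed e obj mul]
  have "is_pseudomonoid ?P \<longleftrightarrow> is_cell2 (assoc2 ?P) \<and>
      mul_cell C m \<beta> \<circ>\<^sub>1 (unit_cell C e \<boxtimes>\<^sub>1 id1 C) = lunit1 C \<and>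
      mul_cell C m \<beta> \<circ>\<^sub>1 (id1 C \<boxtimes>\<^sub>1 unit_cell C e) = runit1 C \<and> pentagon ?P \<and> triangle ?P"
    using True by (auto simp: is_pseudomonoid_def Let_def is_iso2_iff is_cell2_id2 is_cell1_lunit1 is_cell1_runit1)
  also have "\<dots> \<longleftrightarrow> is_cell2 (assoc2 ?P) \<and>
     ((\<forall>x \<in> points C. m (e, x) = x) \<and> (\<forall>\<sigma> \<in> carrier G. \<forall>x \<in> points C. \<beta> (\<sigma>, e, x) = 1)) \<and>
     ((\<forall>x \<in> points C. m (x, e) = x) \<and> (\<forall>\<sigma> \<in> carrier G. \<forall>x \<in> points C. \<beta> (\<sigma>, x, e) = 1)) \<and>
     pentagon ?P \<and> (\<forall>k \<in> points C. \<forall>l \<in> points C. \<theta> ((k, e), l) = 1)"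
    \<comment> \<open>The triangle equivalence is conditional; its premises are the unit laws and
      normalizations in the neighbouring conjuncts.\<close>
    unfolding iffs(1,2) using iffs(3) by auto
  also have "\<dots> \<longleftrightarrow> ?R" (is "?L \<longleftrightarrow> _")
  proof
    assume ?L
    then show ?R
      using True
      unfolding iffs(4,5) strict_pseudomon_data_def Let_def is_cell1_mul_cell_iff[OF obj]
        is_cell1_unit_cell_iff[OF obj]
      by (elim conjE) (intro conjI; assumption)
  next
    assume ?R
    then show ?L
      unfolding iffs(4,5) strict_pseudomon_data_def Let_def
      by (elim conjE) (intro conjI; assumption)
  qed
  finally show ?thesis .
next
  case False
  moreover have "?R \<Longrightarrow> is_obj C \<and> is_cell1 (mul_cell C m \<beta>) \<and> is_cell1 (unit_cell C e)"
    unfolding strict_pseudomon_data_def Let_def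
    by (simp add: is_cell1_mul_cell_iff is_cell1_unit_cell_iff)
  ultimately show ?thesis
    by (auto simp: is_pseudomonoid_def Let_def)
qed

end


section \<open>Cocycle data\<close>

lemma monoid_of_simps [simp]:
  "carrier (monoid_of D) = set_of D" "x \<otimes>\<^bsub>monoid_of D\<^esub> y = mul_of D (x, y)" "\<one>\<^bsub>monoid_of D\<^esub> = one_of D"
  by (simp_all add: monoid_of_def)

context discrete_group
begin

section \<open>Cochains and cocycle equations in explicit variables\<close>

lemma cochains_iff:
  "F \<in> cochains K p q \<longleftrightarrow> F \<in> extensional (nlists p (carrier G) \<times> nlists q (carrier K)) \<and>
    (\<forall>gs \<in> nlists p (carrier G). \<forall>ks \<in> nlists q (carrier K).
      norm (F (gs, ks)) = 1 \<and> (\<one> \<in> set gs \<or> \<one>\<^bsub>K\<^esub> \<in> set ks \<longrightarrow> F (gs, ks) = 1))"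
  unfolding cochains_def by (auto simp: PiE_iff)

lemma cochains_2_1_iff:
  "F \<in> cochains K 2 1 \<longleftrightarrow> F \<in> extensional (nlists 2 (carrier G) \<times> nlists 1 (carrier K)) \<and>
    (\<forall>\<sigma> \<in> carrier G. \<forall>\<tau> \<in> carrier G. \<forall>k \<in> carrier K. norm (F ([\<sigma>, \<tau>], [k])) = 1 \<and>
      (\<sigma> = \<one> \<or> \<tau> = \<one> \<or> k = \<one>\<^bsub>K\<^esub> \<longrightarrow> F ([\<sigma>, \<tau>], [k]) = 1))"
  unfolding cochains_iff by (auto simp: ball_nlists_numeral)

lemma cochains_1_2_iff:
  "F \<in> cochains K 1 2 \<longleftrightarrow> F \<in> extensional (nlists 1 (carrier G) \<times> nlists 2 (carrier K)) \<and>
    (\<forall>\<sigma> \<in> carrier G. \<forall>k \<in> carrier K. \<forall>l \<in> carrier K. norm (F ([\<sigma>], [k, l])) = 1 \<and>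
      (\<sigma> = \<one> \<or> k = \<one>\<^bsub>K\<^esub> \<or> l = \<one>\<^bsub>K\<^esub> \<longrightarrow> F ([\<sigma>], [k, l]) = 1))"
  unfolding cochains_iff by (auto simp: ball_nlists_numeral)

lemma cochains_0_3_iff:
  "F \<in> cochains K 0 3 \<longleftrightarrow> F \<in> extensional (nlists 0 (carrier G) \<times> nlists 3 (carrier K)) \<and>
    (\<forall>k \<in> carrier K. \<forall>l \<in> carrier K. \<forall>n \<in> carrier K. norm (F ([], [k, l, n])) = 1 \<and>
      (k = \<one>\<^bsub>K\<^esub> \<or> l = \<one>\<^bsub>K\<^esub> \<or> n = \<one>\<^bsub>K\<^esub> \<longrightarrow> F ([], [k, l, n]) = 1))"
  unfolding cochains_iff by (auto simp: ball_nlists_numeral)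

text \<open>Moves terms across each equation, which is possible because cochain values are nonzero,
  until it has literally the form found in \<open>is_obj\<close>, \<open>is_cell1\<close>,
  \<open>is_cell2\<close> and the pentagon.\<close>

lemma Tot_cocycle_3_iff_equations:
  assumes closed: "\<And>k l. k \<in> carrier K \<Longrightarrow> l \<in> carrier K \<Longrightarrow> k \<otimes>\<^bsub>K\<^esub> l \<in> carrier K"
    and act: "\<And>g k. g \<in> carrier G \<Longrightarrow> k \<in> carrier K \<Longrightarrow> \<phi> g k \<in> carrier K"
    and \<alpha>: "\<alpha> \<in> cochains K 2 1" and \<beta>: "\<beta> \<in> cochains K 1 2" and \<theta>: "\<theta> \<in> cochains K 0 3"
  shows "Tot_cocycle K \<phi> 3 (direct_sum3 K \<alpha> \<beta> \<theta>) \<longleftrightarrow>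
    (\<forall>\<sigma> \<in> carrier G. \<forall>\<tau> \<in> carrier G. \<forall>\<rho> \<in> carrier G. \<forall>k \<in> carrier K.
      \<alpha> ([\<tau>, \<rho>], [k]) * inverse (\<alpha> ([\<sigma> \<otimes> \<tau>, \<rho>], [k])) * \<alpha> ([\<sigma>, \<tau> \<otimes> \<rho>], [k])
        * inverse (\<alpha> ([\<sigma>, \<tau>], [\<phi> \<rho> k])) = 1) \<and>
    (\<forall>\<sigma> \<in> carrier G. \<forall>\<tau> \<in> carrier G. \<forall>k \<in> carrier K. \<forall>l \<in> carrier K.
      \<beta> ([\<tau>], [k, l]) * inverse (\<beta> ([\<sigma> \<otimes> \<tau>], [k, l])) * \<beta> ([\<sigma>], [\<phi> \<tau> k, \<phi> \<tau> l])
        = \<alpha> ([\<sigma>, \<tau>], [k \<otimes>\<^bsub>K\<^esub> l]) * inverse (\<alpha> ([\<sigma>, \<tau>], [k]) * \<alpha> ([\<sigma>, \<tau>], [l]))) \<and>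
    (\<forall>\<sigma> \<in> carrier G. \<forall>k \<in> carrier K. \<forall>l \<in> carrier K. \<forall>n \<in> carrier K.
      \<theta> ([], [k, l, n]) * inverse (\<theta> ([], [\<phi> \<sigma> k, \<phi> \<sigma> l, \<phi> \<sigma> n]))
        = \<beta> ([\<sigma>], [k, l \<otimes>\<^bsub>K\<^esub> n]) * \<beta> ([\<sigma>], [l, n])
          * inverse (\<beta> ([\<sigma>], [k \<otimes>\<^bsub>K\<^esub> l, n]) * \<beta> ([\<sigma>], [k, l]))) \<and>
    (\<forall>k \<in> carrier K. \<forall>l \<in> carrier K. \<forall>n \<in> carrier K. \<forall>r \<in> carrier K.
      \<theta> ([], [k, l, n \<otimes>\<^bsub>K\<^esub> r]) * \<theta> ([], [k \<otimes>\<^bsub>K\<^esub> l, n, r])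
        = \<theta> ([], [l, n, r]) * \<theta> ([], [k, l \<otimes>\<^bsub>K\<^esub> n, r]) * \<theta> ([], [k, l, n]))"
proof -
  have nonzero:
    "\<And>\<sigma> \<tau> k. \<sigma> \<in> carrier G \<Longrightarrow> \<tau> \<in> carrier G \<Longrightarrow> k \<in> carrier K \<Longrightarrow> \<alpha> ([\<sigma>, \<tau>], [k]) \<noteq> 0"
    "\<And>\<sigma> k l. \<sigma> \<in> carrier G \<Longrightarrow> k \<in> carrier K \<Longrightarrow> l \<in> carrier K \<Longrightarrow> \<beta> ([\<sigma>], [k, l]) \<noteq> 0"
    "\<And>k l n. k \<in> carrier K \<Longrightarrow> l \<in> carrier K \<Longrightarrow> n \<in> carrier K \<Longrightarrow> \<theta> ([], [k, l, n]) \<noteq> 0"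
    using \<alpha> \<beta> \<theta> unfolding cochains_2_1_iff cochains_1_2_iff cochains_0_3_iff
    by (metis norm_zero zero_neq_one)+
  have eq2: "delta_G K \<phi> 1 2 \<beta> ([\<sigma>, \<tau>], [k, l]) * delta_K K 2 1 \<alpha> ([\<sigma>, \<tau>], [k, l]) = 1 \<longleftrightarrow>
      \<beta> ([\<tau>], [k, l]) * inverse (\<beta> ([\<sigma> \<otimes> \<tau>], [k, l])) * \<beta> ([\<sigma>], [\<phi> \<tau> k, \<phi> \<tau> l])
        = \<alpha> ([\<sigma>, \<tau>], [k \<otimes>\<^bsub>K\<^esub> l]) * inverse (\<alpha> ([\<sigma>, \<tau>], [k]) * \<alpha> ([\<sigma>, \<tau>], [l]))"
    if "\<sigma> \<in> carrier G" "\<tau> \<in> carrier G" "k \<in> carrier K" "l \<in> carrier K" for \<sigma> \<tau> k l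
    using that by (simp add: delta_G_simps delta_K_simps nonzero closed act field_simps del: One_nat_def)
  have eq3: "delta_G K \<phi> 0 3 \<theta> ([\<sigma>], [k, l, n]) * inverse (delta_K K 1 2 \<beta> ([\<sigma>], [k, l, n])) = 1 \<longleftrightarrow>
      \<theta> ([], [k, l, n]) * inverse (\<theta> ([], [\<phi> \<sigma> k, \<phi> \<sigma> l, \<phi> \<sigma> n]))
        = \<beta> ([\<sigma>], [k, l \<otimes>\<^bsub>K\<^esub> n]) * \<beta> ([\<sigma>], [l, n])
          * inverse (\<beta> ([\<sigma>], [k \<otimes>\<^bsub>K\<^esub> l, n]) * \<beta> ([\<sigma>], [k, l]))"
    if "\<sigma> \<in> carrier G" "k \<in> carrier K" "l \<in> carrier K" "n \<in> carrier K" for \<sigma> k l n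
    using that by (simp add: delta_G_simps delta_K_simps nonzero closed act field_simps del: One_nat_def)
  have eq4: "delta_K K 0 3 \<theta> ([], [k, l, n, r]) = 1 \<longleftrightarrow>
      \<theta> ([], [k, l, n \<otimes>\<^bsub>K\<^esub> r]) * \<theta> ([], [k \<otimes>\<^bsub>K\<^esub> l, n, r])
        = \<theta> ([], [l, n, r]) * \<theta> ([], [k, l \<otimes>\<^bsub>K\<^esub> n, r]) * \<theta> ([], [k, l, n])"
    if "k \<in> carrier K" "l \<in> carrier K" "n \<in> carrier K" "r \<in> carrier K" for k l n r
    using that by (auto simp add: delta_K_simps nonzero closed act field_simps del: One_nat_def)
  show ?thesis
    \<comment> \<open>The rewrite rules are conditional on membership in the carriers;
      \<open>ball_cong\<close> supplies it from the bounded quantifiers.\<close>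
    by (simp only: Tot_cocycle_3_iff[OF assms] eq2 eq3 eq4 delta_G_simps(1) cong: ball_cong)
qed

section \<open>Passage between cochains on lists and functions on tuples\<close>

definition twisted_set_of :: "('g, 'k) cocycle_data \<Rightarrow> ('g, 'k) tw_set"
  where "twisted_set_of D = \<lparr>points = set_of D, act = act_of D,
    twist = (\<lambda>(\<sigma>, \<tau>, k) \<in> carrier G \<times> carrier G \<times> set_of D. alpha_of D ([\<sigma>, \<tau>], [k]))\<rparr>"

definition beta_map_of :: "('g, 'k) cocycle_data \<Rightarrow> 'g \<times> 'k \<times> 'k \<Rightarrow> complex"
  where "beta_map_of D = (\<lambda>(\<sigma>, k, l) \<in> carrier G \<times> set_of D \<times> set_of D. beta_of D ([\<sigma>], [k, l]))"

definition theta_map_of :: "('g, 'k) cocycle_data \<Rightarrow> ('k \<times> 'k) \<times> 'k \<Rightarrow> complex"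
  where "theta_map_of D =
    (\<lambda>((k, l), n) \<in> (set_of D \<times> set_of D) \<times> set_of D. theta_of D ([], [k, l, n]))"

lemma pseudomonoid_of_eq:
  "pseudomonoid_of D =
    strict_pseudomon (twisted_set_of D) (mul_of D) (one_of D) (beta_map_of D) (theta_map_of D)"
  by (simp add: pseudomonoid_of_def strict_pseudomon_def mul_cell_def unit_cell_def Let_def
      twisted_set_of_def beta_map_of_def theta_map_of_def)

lemma map_of_simps [simp]:
  "points (twisted_set_of D) = set_of D" "act (twisted_set_of D) = act_of D"
  "\<sigma> \<in> carrier G \<Longrightarrow> \<tau> \<in> carrier G \<Longrightarrow> k \<in> set_of D \<Longrightarrow>
    twist (twisted_set_of D) (\<sigma>, \<tau>, k) = alpha_of D ([\<sigma>, \<tau>], [k])"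
  "\<sigma> \<in> carrier G \<Longrightarrow> k \<in> set_of D \<Longrightarrow> l \<in> set_of D \<Longrightarrow>
    beta_map_of D (\<sigma>, k, l) = beta_of D ([\<sigma>], [k, l])"
  "k \<in> set_of D \<Longrightarrow> l \<in> set_of D \<Longrightarrow> n \<in> set_of D \<Longrightarrow>
    theta_map_of D ((k, l), n) = theta_of D ([], [k, l, n])"
  by (simp_all add: twisted_set_of_def beta_map_of_def theta_map_of_def)

lemma map_of_extensional [simp]:
  "twist (twisted_set_of D) \<in> extensional (carrier G \<times> carrier G \<times> set_of D)"
  "beta_map_of D \<in> extensional (carrier G \<times> set_of D \<times> set_of D)"
  "theta_map_of D \<in> extensional ((set_of D \<times> set_of D) \<times> set_of D)"
  by (simp_all add: twisted_set_of_def beta_map_of_def theta_map_of_def)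

text \<open>The tuple functions read a cochain only at lists of the right length over the carriers,
  so its behaviour elsewhere must be recorded separately.\<close>

definition extensional_data :: "('g, 'k) cocycle_data \<Rightarrow> bool"
  where "extensional_data D \<longleftrightarrow>
    alpha_of D \<in> extensional (nlists 2 (carrier G) \<times> nlists 1 (set_of D)) \<and>
    beta_of D \<in> extensional (nlists 1 (carrier G) \<times> nlists 2 (set_of D)) \<and>
    theta_of D \<in> extensional (nlists 0 (carrier G) \<times> nlists 3 (set_of D))"

lemma is_Gset_closed: "is_Gset X \<phi> \<Longrightarrow> \<sigma> \<in> carrier G \<Longrightarrow> x \<in> X \<Longrightarrow> \<phi> \<sigma> x \<in> X"
  by (auto simp: is_Gset_iff)

lemma is_cocycle_data_imp:
  assumes "is_cocycle_data D"
  shows "extensional_data D"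
    and "strict_pseudomon_data (twisted_set_of D) (mul_of D) (one_of D) (beta_map_of D) (theta_map_of D)"
proof -
  let ?K = "set_of D" and ?M = "monoid_of D"
  have Gset: "is_Gset ?K (act_of D)" and mul: "mul_of D \<in> ?K \<times> ?K \<rightarrow>\<^sub>E ?K" and monoid: "monoid ?M"
    and equivariant: "\<forall>g \<in> carrier G. \<forall>x \<in> ?K. \<forall>y \<in> ?K.
      mul_of D (act_of D g x, act_of D g y) = act_of D g (mul_of D (x, y))"
    and invariant: "\<forall>g \<in> carrier G. act_of D g (one_of D) = one_of D"
    and \<alpha>: "alpha_of D \<in> cochains ?M 2 1" and \<beta>: "beta_of D \<in> cochains ?M 1 2"
    and \<theta>: "theta_of D \<in> cochains ?M 0 3"
    and cocycle: "Tot_cocycle ?M (act_of D) 3 (direct_sum3 ?M (alpha_of D) (beta_of D) (theta_of D))"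
    using assms by (simp_all add: is_cocycle_data_def Let_def)
  note monoid_laws = monoid.one_closed[OF monoid] monoid.m_assoc[OF monoid]
    monoid.l_one[OF monoid] monoid.r_one[OF monoid] monoid.m_closed[OF monoid]
  show "extensional_data D"
    using \<alpha> \<beta> \<theta>
    by (simp add: extensional_data_def cochains_2_1_iff cochains_1_2_iff cochains_0_3_iff del: One_nat_def)
  have closed: "k \<otimes>\<^bsub>?M\<^esub> l \<in> carrier ?M" if "k \<in> carrier ?M" "l \<in> carrier ?M" for k l
    using monoid.m_closed[OF monoid] that .
  have act: "act_of D \<sigma> k \<in> carrier ?M" if "\<sigma> \<in> carrier G" "k \<in> carrier ?M" for \<sigma> k
    using is_Gset_closed[OF Gset] that by simp
  \<comment> \<open>In order: the cocycle condition of the object, the coboundary condition of the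
    multiplication, the 2-cell condition of the associator, and the pentagon.\<close>
  note equations = iffD1[OF Tot_cocycle_3_iff_equations[OF closed act \<alpha> \<beta> \<theta>] cocycle,
      unfolded monoid_of_simps]
  have one: "one_of D \<in> ?K"
    using monoid_laws(1) by simp
  have \<beta>_one: "beta_of D ([\<one>], [k, l]) = 1" if "k \<in> ?K" "l \<in> ?K" for k l
    using \<beta> that one_closed unfolding cochains_1_2_iff monoid_of_simps by blast
  have "is_obj (twisted_set_of D)"
    unfolding is_obj_def
    using Gset \<alpha> equations act by (simp add: cochains_2_1_iff PiE_iff del: One_nat_def)
  then show "strict_pseudomon_data (twisted_set_of D) (mul_of D) (one_of D) (beta_map_of D) (theta_map_of D)"
    unfolding strict_pseudomon_data_def Let_def
    using mul equivariant invariant \<alpha> \<beta> \<theta> equations act closed monoid_laws one \<beta>_one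
    by (simp add: cochains_2_1_iff cochains_1_2_iff cochains_0_3_iff PiE_iff del: One_nat_def)
qed

text \<open>The converse has to recover the full normalization of \<open>\<theta>\<close>, of which
  the data contain only the middle variable.\<close>

lemma is_cocycle_data_if:
  assumes "extensional_data D"
    and "strict_pseudomon_data (twisted_set_of D) (mul_of D) (one_of D) (beta_map_of D) (theta_map_of D)"
  shows "is_cocycle_data D"
proof -
  let ?K = "set_of D" and ?M = "monoid_of D"
  let ?\<theta> = "\<lambda>k l n. theta_of D ([], [k, l, n])"
  note data = assms(2)[unfolded strict_pseudomon_data_def Let_def map_of_simps]
  have obj: "is_obj (twisted_set_of D)"
    using data by simp
  note act = act_closed[OF obj, unfolded map_of_simps]
  have mul: "mul_of D \<in> ?K \<times> ?K \<rightarrow>\<^sub>E ?K" and e: "one_of D \<in> ?K"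
    and unit: "\<And>k. k \<in> ?K \<Longrightarrow> mul_of D (one_of D, k) = k" "\<And>k. k \<in> ?K \<Longrightarrow> mul_of D (k, one_of D) = k"
    using data by simp_all
  have closed: "mul_of D (k, l) \<in> ?K" if "k \<in> ?K" "l \<in> ?K" for k l
    using mul that by blast
  have monoid: "monoid ?M"
    using data closed by unfold_locales auto
  have norm_\<theta>: "norm (?\<theta> k l n) = 1" if "k \<in> ?K" "l \<in> ?K" "n \<in> ?K" for k l n
    using data that by (auto simp: PiE_iff)
  have \<theta>_mid: "?\<theta> k (one_of D) n = 1" if "k \<in> ?K" "n \<in> ?K" for k n
    using data that e by auto
  have pentagon: "?\<theta> k l (mul_of D (n, r)) * ?\<theta> (mul_of D (k, l)) n r
      = ?\<theta> l n r * ?\<theta> k (mul_of D (l, n)) r * ?\<theta> k l n"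
    if "k \<in> ?K" "l \<in> ?K" "n \<in> ?K" "r \<in> ?K" for k l n r
    using data that closed by auto
  \<comment> \<open>By \<open>\<theta>_mid\<close> the factors with a unit in the middle drop out
    and \<open>x = x * x\<close> remains for the value \<open>x\<close> in question;
    \<open>norm_\<theta>\<close> excludes \<open>x = 0\<close>.\<close>
  have \<theta>_left: "?\<theta> (one_of D) n r = 1" if "n \<in> ?K" "r \<in> ?K" for n r
    using pentagon[of "one_of D" "one_of D" n r] norm_\<theta>[of "one_of D" n r] that
    by (auto simp: e unit closed \<theta>_mid)
  have \<theta>_right: "?\<theta> k l (one_of D) = 1" if "k \<in> ?K" "l \<in> ?K" for k l
    using pentagon[of k l "one_of D" "one_of D"] norm_\<theta>[of k l "one_of D"] that
    by (auto simp: e unit closed \<theta>_mid)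
  have \<theta>: "theta_of D \<in> cochains ?M 0 3"
    using assms(1) norm_\<theta> \<theta>_left \<theta>_mid \<theta>_right by (auto simp: cochains_0_3_iff extensional_data_def)
  have \<beta>: "beta_of D \<in> cochains ?M 1 2"
    using assms(1) data by (auto simp: cochains_1_2_iff extensional_data_def PiE_iff simp del: One_nat_def)
  \<comment> \<open>Normalization in the group variables comes from the object, in the monoid
    variable from the unit 1-cell.\<close>
  have \<alpha>: "alpha_of D \<in> cochains ?M 2 1"
    using assms(1) data norm_twist[OF obj] twist_one[OF obj]
    by (auto simp: cochains_2_1_iff extensional_data_def simp del: One_nat_def)
  have "Tot_cocycle ?M (act_of D) 3 (direct_sum3 ?M (alpha_of D) (beta_of D) (theta_of D))"
    \<comment> \<open>The object supplies the equation in bidegree \<open>(3, 1)\<close>; the other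
      three are among the data.\<close>
    using data twist_cocycle[OF obj]
    by (subst Tot_cocycle_3_iff_equations[OF _ _ \<alpha> \<beta> \<theta>]) (simp_all add: closed act)
  then show ?thesis
    using obj mul monoid \<alpha> \<beta> \<theta> data unfolding is_cocycle_data_def Let_def
    by (simp add: is_obj_def)
qed

text \<open>Yields injectivity: the tuple functions determine a cochain on its domain, and
  extensionality determines it elsewhere.\<close>

lemma cocycle_data_eqI:
  assumes "extensional_data D" "extensional_data D'"
    and "twisted_set_of D = twisted_set_of D'" "mul_of D = mul_of D'" "one_of D = one_of D'"
    and "beta_map_of D = beta_map_of D'" "theta_map_of D = theta_map_of D'"
  shows "D = D'"
proof (rule cocycle_data.equality)
  show set: "set_of D = set_of D'" and "act_of D = act_of D'"
    using assms(3) by (simp_all add: twisted_set_of_def)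
  show "alpha_of D = alpha_of D'"
  proof (rule extensionalityI)
    show "alpha_of D x = alpha_of D' x" if "x \<in> nlists 2 (carrier G) \<times> nlists 1 (set_of D)" for x
    proof -
      obtain \<sigma> \<tau> k where x: "x = ([\<sigma>, \<tau>], [k])" "\<sigma> \<in> carrier G" "\<tau> \<in> carrier G" "k \<in> set_of D"
        using \<open>x \<in> _\<close> by (auto simp: in_nlists_Suc_iff numeral_2_eq_2)
      then show ?thesis
        using arg_cong[OF assms(3), of "\<lambda>C. twist C (\<sigma>, \<tau>, k)"] set by simp
    qed
  qed (use assms(1,2) set in \<open>simp_all add: extensional_data_def del: One_nat_def\<close>)
  show "beta_of D = beta_of D'"
  proof (rule extensionalityI)
    show "beta_of D x = beta_of D' x" if "x \<in> nlists 1 (carrier G) \<times> nlists 2 (set_of D)" for x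
    proof -
      obtain \<sigma> k l where x: "x = ([\<sigma>], [k, l])" "\<sigma> \<in> carrier G" "k \<in> set_of D" "l \<in> set_of D"
        using \<open>x \<in> _\<close> by (auto simp: in_nlists_Suc_iff numeral_2_eq_2)
      then show ?thesis
        using fun_cong[OF assms(6), of "(\<sigma>, k, l)"] set by simp
    qed
  qed (use assms(1,2) set in \<open>simp_all add: extensional_data_def del: One_nat_def\<close>)
  show "theta_of D = theta_of D'"
  proof (rule extensionalityI)
    show "theta_of D x = theta_of D' x" if "x \<in> nlists 0 (carrier G) \<times> nlists 3 (set_of D)" for x
    proof -
      obtain k l n where x: "x = ([], [k, l, n])" "k \<in> set_of D" "l \<in> set_of D" "n \<in> set_of D"
        using \<open>x \<in> _\<close> by (auto simp: in_nlists_Suc_iff numeral_3_eq_3)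
      then show ?thesis
        using fun_cong[OF assms(7), of "((k, l), n)"] set by simp
    qed
  qed (use assms(1,2) set in \<open>simp_all add: extensional_data_def del: One_nat_def\<close>)
qed (use assms in simp_all)

text \<open>Yields surjectivity: every function on tuples comes from a cochain on lists.\<close>

lemma strict_pseudomon_data_eq_maps_of:
  assumes "strict_pseudomon_data C m e \<beta> \<theta>"
  obtains D where "extensional_data D" "twisted_set_of D = C" "mul_of D = m" "one_of D = e"
    "beta_map_of D = \<beta>" "theta_map_of D = \<theta>"
proof
  \<comment> \<open>The cochains of \<open>?D\<close> read the tuple entries off the lists by
    position, starting at 0.\<close>
  let ?K = "points C"
  let ?D = "\<lparr>set_of = ?K, act_of = act C, mul_of = m, one_of = e,
    alpha_of = (\<lambda>(gs, ks) \<in> nlists 2 (carrier G) \<times> nlists 1 ?K. twist C (gs ! 0, gs ! 1, ks ! 0)),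
    beta_of = (\<lambda>(gs, ks) \<in> nlists 1 (carrier G) \<times> nlists 2 ?K. \<beta> (gs ! 0, ks ! 0, ks ! 1)),
    theta_of = (\<lambda>(gs, ks) \<in> nlists 0 (carrier G) \<times> nlists 3 ?K. \<theta> ((ks ! 0, ks ! 1), ks ! 2))\<rparr>"
  show "extensional_data ?D"
    by (simp add: extensional_data_def)
  \<comment> \<open>Going to lists and back restricts to the carriers; this returns the original
    functions because they are extensional.\<close>
  have ext: "twist C \<in> extensional (carrier G \<times> carrier G \<times> ?K)"
    "\<beta> \<in> extensional (carrier G \<times> ?K \<times> ?K)" "\<theta> \<in> extensional ((?K \<times> ?K) \<times> ?K)"
    using assms by (auto simp: strict_pseudomon_data_def Let_def is_obj_def PiE_iff)
  have "twist (twisted_set_of ?D) = twist C"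
    by (rule extensionalityI[OF _ ext(1)])
      (auto simp: twisted_set_of_def eval_nat_numeral)
  then show "twisted_set_of ?D = C"
    by (intro tw_set.equality) simp_all
  show "beta_map_of ?D = \<beta>"
    by (rule extensionalityI[OF _ ext(2)])
      (auto simp: beta_map_of_def eval_nat_numeral)
  show "theta_map_of ?D = \<theta>"
    by (rule extensionalityI[OF _ ext(3)])
      (auto simp: theta_map_of_def eval_nat_numeral)
qed simp_all

section \<open>The bijection between cocycle data and strictly unital pseudomonoids\<close>

lemma has_strict_unit_strict_pseudomon: "has_strict_unit (strict_pseudomon C m e \<beta> \<theta>)"
  by (simp add: has_strict_unit_def) (simp add: unit_cell_def)

lemma strict_pseudomon_inject:
  assumes "strict_pseudomon C m e \<beta> \<theta> = strict_pseudomon C' m' e' \<beta>' \<theta>'"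
  shows "C = C'" "m = m'" "e = e'" "\<beta> = \<beta>'" "\<theta> = \<theta>'"
  \<comment> \<open>The equality of units is read off from two equal constant maps on the one-point
    set, by \<open>fun_cong\<close>.\<close>
  using assms by (auto simp: strict_pseudomon_def mul_cell_def unit_cell_def dest: fun_cong)

text \<open>Serves both inclusions of the image computation: once \<open>D\<close> is extensional,
  being cocycle data can be tested on its image.\<close>

lemma is_cocycle_data_iff:
  "is_cocycle_data D \<longleftrightarrow> extensional_data D \<and> is_pseudomonoid (pseudomonoid_of D)"
  unfolding pseudomonoid_of_eq is_pseudomonoid_strict_pseudomon_iff
  using is_cocycle_data_imp is_cocycle_data_if by blast

lemma bij_betw_pseudomonoid_of:
  "bij_betw pseudomonoid_of {D :: ('g, 'k) cocycle_data. is_cocycle_data D}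
    {P :: ('g, 'k) pseudomon. is_pseudomonoid P \<and> has_strict_unit P}"
  unfolding bij_betw_def
proof
  show "inj_on pseudomonoid_of {D :: ('g, 'k) cocycle_data. is_cocycle_data D}"
    by (auto simp: inj_on_def pseudomonoid_of_eq is_cocycle_data_iff
        intro!: cocycle_data_eqI dest: strict_pseudomon_inject)
  show "pseudomonoid_of ` {D :: ('g, 'k) cocycle_data. is_cocycle_data D}
    = {P :: ('g, 'k) pseudomon. is_pseudomonoid P \<and> has_strict_unit P}"
  proof (intro equalityI subsetI)
    fix P :: "('g, 'k) pseudomon"
    assume "P \<in> {P. is_pseudomonoid P \<and> has_strict_unit P}"
    then have P: "is_pseudomonoid P" "has_strict_unit P"
      by auto
    obtain C m e \<beta> \<theta> where eq: "P = strict_pseudomon C m e \<beta> \<theta>"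
      using eq_strict_pseudomon[OF P] by blast
    then have "strict_pseudomon_data C m e \<beta> \<theta>"
      using P(1) by (simp add: is_pseudomonoid_strict_pseudomon_iff)
    \<comment> \<open>No cocycle condition has to be checked for this \<open>D\<close>: its image is
      the pseudomonoid \<open>P\<close>, so \<open>is_cocycle_data_iff\<close> applies.\<close>
    then obtain D where "extensional_data D" "pseudomonoid_of D = P"
      using strict_pseudomon_data_eq_maps_of eq pseudomonoid_of_eq by metis
    then show "P \<in> pseudomonoid_of ` {D. is_cocycle_data D}"
      using P(1) by (auto simp: is_cocycle_data_iff)
  next
    fix P :: "('g, 'k) pseudomon"
    assume "P \<in> pseudomonoid_of ` {D. is_cocycle_data D}"
    then show "P \<in> {P. is_pseudomonoid P \<and> has_strict_unit P}"
      by (auto simp: is_cocycle_data_iff pseudomonoid_of_eq has_strict_unit_strict_pseudomon)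
  qed
qed

end

theorem proposition3p4:
  fixes G :: "('g, 'b) monoid_scheme"
  assumes "group G"
  shows "bij_betw (discrete_group.pseudomonoid_of G)
           {D :: ('g, 'k) cocycle_data. discrete_group.is_cocycle_data G D}
           {P :: ('g, 'k) pseudomon. discrete_group.is_pseudomonoid G P \<and> discrete_group.has_strict_unit G P}"
  using discrete_group.bij_betw_pseudomonoid_of[OF discrete_group.intro[OF assms]] .

end
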